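(* The projection $S_{23}$ consists precisely of the points $(d_2,d_3)\in\mathbb{R}^2$ such that $d_2\ge0$, $d_3\ge0$ (and $d_3\le 1$) and $d_2\le\frac32\big(g_R^{-1}(d_3)-d_3\big)$.
   Context: For a finite graph $G$ and a $k$-vertex graph $H$, $d(H,G)$ is the probability that a uniformly random $k$-element subset of $V(G)$ induces a subgraph isomorphic to $H$. For $k\in\{0,1,2,3\}$ let $H_k$ be the 3-vertex graph with exactly $k$ edges. Let $S\subseteq\mathbb{R}^4$ be the set of all $(d_0,d_1,d_2,d_3)$ such that for every $\varepsilon>0$ and every $n\in\mathbb{N}$ there is a graph $G$ with at least $n$ vertices satisfying $|d(H_k,G)-d_k|\le\varepsilon$ for $k=0,1,2,3$. For $i<j$, $S_{ij}=\{(d_i,d_j):(d_0,d_1,d_2,d_3)\in S\}$. The function $g_R:[0,1]\to[0,1]$ (Razborov's minimum triangle density function) is defined by $g_R(d)=0$ for $d\in[0,1/2]$, $g_R(1)=1$, and for $d\in(1/2,1)$: let $k$ be the smallest integer with $d\le 1-1/k$, let $z$ be the unique real in $(0,1/k]$ with $d=\frac{(1-z)(kz+k-2)}{k-1}$, and set $g_R(d)=\frac{(1-z)^2(k-2)(2zk+k-3)}{(k-1)^2}$. (This is the triangle density of a complete $k$-partite graph with one part of relative size $z$ and $k-1$ equal parts.) The restriction of $g_R$ to $[1/2,1]$ is a continuous increasing bijection onto $[0,1]$, and $g_R^{-1}:[0,1]\to[1/2,1]$ denotes its inverse. *)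

theory Defs
  imports Complex_Main
begin

text \<open>A finite simple graph on natural-number vertices: a vertex set together with
  an edge relation; only edges between vertices of the vertex set are considered.\<close>
type_synonym graph = "nat set \<times> (nat \<Rightarrow> nat \<Rightarrow> bool)"

definition verts :: "graph \<Rightarrow> nat set" where "verts G = fst G"
definition adj :: "graph \<Rightarrow> nat \<Rightarrow> nat \<Rightarrow> bool" where "adj G = snd G"

definition wf_graph :: "graph \<Rightarrow> bool" where
  "wf_graph G \<longleftrightarrow> finite (verts G) \<and>
     (\<forall>x y. adj G x y \<longrightarrow> adj G y x) \<and> (\<forall>x. \<not> adj G x x)"

definition induced :: "graph \<Rightarrow> nat set \<Rightarrow> graph" where
  "induced G U = (U, \<lambda>x y. x \<in> U \<and> y \<in> U \<and> adj G x y)"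

definition graph_iso :: "graph \<Rightarrow> graph \<Rightarrow> bool" where
  "graph_iso H G \<longleftrightarrow> (\<exists>f. bij_betw f (verts H) (verts G) \<and>
     (\<forall>x\<in>verts H. \<forall>y\<in>verts H. adj H x y \<longleftrightarrow> adj G (f x) (f y)))"

definition ind_density :: "graph \<Rightarrow> graph \<Rightarrow> real" where
  "ind_density H G =
     real (card {U. U \<subseteq> verts G \<and> card U = card (verts H) \<and> graph_iso (induced G U) H})
     / real (card (verts G) choose card (verts H))"

definition H3 :: "nat \<Rightarrow> graph" where
  "H3 k = ({0,1,2},
     \<lambda>x y. {x,y} \<in> (if k = 0 then {} else if k = 1 then {{0,1}}
                     else if k = 2 then {{0,1},{1,2}} else {{0,1},{1,2},{0,2}}))"

definition S_set :: "(real \<times> real \<times> real \<times> real) set" where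
  "S_set = {(d0,d1,d2,d3). \<forall>\<epsilon>>0. \<forall>n::nat. \<exists>G. wf_graph G \<and> card (verts G) \<ge> n \<and>
      \<bar>ind_density (H3 0) G - d0\<bar> \<le> \<epsilon> \<and> \<bar>ind_density (H3 1) G - d1\<bar> \<le> \<epsilon> \<and>
      \<bar>ind_density (H3 2) G - d2\<bar> \<le> \<epsilon> \<and> \<bar>ind_density (H3 3) G - d3\<bar> \<le> \<epsilon>}"

definition S23 :: "(real \<times> real) set" where
  "S23 = {(d2,d3). \<exists>d0 d1. (d0,d1,d2,d3) \<in> S_set}"

text \<open>Razborov's minimum triangle density function.\<close>
definition g_R :: "real \<Rightarrow> real" where
  "g_R d = (if d \<le> 1/2 then 0 else if d \<ge> 1 then 1 else
     (let k = (LEAST k::nat. k \<ge> 1 \<and> d \<le> 1 - 1 / real k);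
          z = (THE z. 0 < z \<and> z \<le> 1 / real k \<and>
                      d = (1 - z) * (real k * z + real k - 2) / (real k - 1))
      in (1 - z)^2 * (real k - 2) * (2 * z * real k + real k - 3) / (real k - 1)^2))"

definition g_R_inv :: "real \<Rightarrow> real" where
  "g_R_inv y = (THE x. x \<in> {1/2..1} \<and> g_R x = y)"

end

theory Submission
  imports Defs "HOL-Analysis.Analysis"
begin

text \<open>
  Write \<open>D\<close>, \<open>E\<close>, \<open>T\<close> for the mass and the (ordered) edge and triangle weights of a weighted graph.
  Counting common non-neighbours of edges gives Goodman's inequality \<open>2 \<Sum> p\<^sub>x d\<^sub>x\<^sup>2 \<le> D E + T\<close>, and
  asymptotically \<open>d\<^sub>2 = 3 (\<Sum> p\<^sub>x d\<^sub>x\<^sup>2 - T)\<close>, so \<open>d\<^sub>2 \<le> 3/2 (E - T)\<close> on total mass 1. With Razborov's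
  theorem \<open>g_R E \<le> T\<close> this is the upper bound.

  Razborov's theorem is proved by induction on the number \<open>m\<close> of big parts. A minimiser of
  \<open>T - g_R E\<close> over all weightings and all symmetric kernels with values in [0,1] exists by
  compactness. If its value is negative, stationarity in the weights makes the edge weight of the
  link of a vertex an affine function of its degree, and stationarity in the kernel bounds the
  codegrees of edges. Inclusion-exclusion over a triangle and a fourth vertex then bounds the
  weight of 4-cliques from above. The induction hypothesis, applied to the links, bounds it from
  below, and the two bounds are incompatible.

  Conversely, take the extremal multipartite graph, join it completely to a clique of relative size
  \<open>1 - u\<close>, and add isolated vertices. Varying \<open>u\<close> moves the ratio \<open>d\<^sub>2 / d\<^sub>3\<close> from its maximum to 0,
  while the isolated vertices keep \<open>d\<^sub>3\<close> fixed.
\<close>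

subsection \<open>Weighted graphs\<close>

text \<open>Competitors live on one fixed finite vertex set, and fractional edge values let single
  kernel entries be lowered continuously, so the variational argument stays within ordinary
  calculus.

  The obstacle in the induction is that a link in a minimiser has no fixed mass and does not lie on
  the extremal curve: its edge weight falls short by a deficit \<open>\<theta>\<close>, the same for
  all vertices of positive weight, and its mass may exceed \<open>m\<close>, where the induction
  hypothesis is silent. Everything is therefore kept homogeneous and normalised so that the big
  parts have weight 1, and each link is shown to lose at most \<open>(4 * m - 6) * \<theta>\<close>
  in its triangle bound. That constant is forced: comparing the two bounds on 4-cliques leaves a
  surplus \<open>\<theta> * (D - m) * (3 * (m + 1) - 2 * D)\<close>, which is positive for
  \<open>m < D \<le> m + 1\<close> but tends to 0 as \<open>D\<close> approaches \<open>m\<close>.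

  The upper bound is attained because an edge of a complete multipartite graph has no common
  non-neighbour, so Goodman's inequality is an equality exactly where Razborov's is.\<close>

definition mass :: "'a set \<Rightarrow> ('a \<Rightarrow> real) \<Rightarrow> real" where
  "mass V p = (\<Sum>x\<in>V. p x)"

definition link :: "('a \<Rightarrow> 'a \<Rightarrow> real) \<Rightarrow> ('a \<Rightarrow> real) \<Rightarrow> 'a \<Rightarrow> 'a \<Rightarrow> real" where
  "link A p x = (\<lambda>y. p y * A x y)"

definition edges :: "'a set \<Rightarrow> ('a \<Rightarrow> 'a \<Rightarrow> real) \<Rightarrow> ('a \<Rightarrow> real) \<Rightarrow> real" where
  "edges V A p = (\<Sum>x\<in>V. p x * mass V (link A p x))"

definition triangles :: "'a set \<Rightarrow> ('a \<Rightarrow> 'a \<Rightarrow> real) \<Rightarrow> ('a \<Rightarrow> real) \<Rightarrow> real" where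
  "triangles V A p = (\<Sum>x\<in>V. p x * edges V A (link A p x))"

definition cliques4 :: "'a set \<Rightarrow> ('a \<Rightarrow> 'a \<Rightarrow> real) \<Rightarrow> ('a \<Rightarrow> real) \<Rightarrow> real" where
  "cliques4 V A p = (\<Sum>x\<in>V. p x * triangles V A (link A p x))"

text \<open>Loops \<open>A x x > 0\<close> are allowed: a vertex stands for a class of vertices that
  may be joined within itself, so this is a step kernel rather than a simple graph.\<close>

definition sym_kernel :: "('a \<Rightarrow> 'a \<Rightarrow> real) \<Rightarrow> bool" where
  "sym_kernel A \<longleftrightarrow> (\<forall>x y. A x y = A y x \<and> 0 \<le> A x y \<and> A x y \<le> 1)"

lemma kernel_scale:
  assumes "sym_kernel A" "0 \<le> c" "c \<le> 1"
  shows "sym_kernel (\<lambda>x y. c * A x y)"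
  using assms by (auto simp: sym_kernel_def mult_le_one)

lemma link_scale: "link A (\<lambda>x. c * p x) x = (\<lambda>y. c * link A p x y)"
  by (auto simp: link_def)

lemma mass_scale: "mass V (\<lambda>x. c * p x) = c * mass V p"
  by (simp add: mass_def sum_distrib_left)

lemma edges_scale: "edges V A (\<lambda>x. c * p x) = c^2 * edges V A p"
  by (simp add: edges_def link_scale mass_scale sum_distrib_left power2_eq_square mult_ac)

lemma triangles_scale: "triangles V A (\<lambda>x. c * p x) = c^3 * triangles V A p"
  by (simp add: triangles_def link_scale edges_scale sum_distrib_left power2_eq_square
      power3_eq_cube mult_ac)

lemma edges_scale_kernel: "edges V (\<lambda>x y. c * A x y) p = c * edges V A p"
  by (simp add: edges_def link_def mass_def sum_distrib_left mult_ac)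

lemma triangles_scale_kernel: "triangles V (\<lambda>x y. c * A x y) p = c^3 * triangles V A p"
  by (simp add: triangles_def edges_def link_def mass_def sum_distrib_left power3_eq_cube mult_ac)

lemma mass_nonneg: "(\<And>x. 0 \<le> p x) \<Longrightarrow> 0 \<le> mass V p"
  by (simp add: mass_def sum_nonneg)

locale weighted_graph =
  fixes V :: "'a set" and A :: "'a \<Rightarrow> 'a \<Rightarrow> real" and p :: "'a \<Rightarrow> real"
  assumes finite_V: "finite V" and kernel: "sym_kernel A" and weight_nonneg: "0 \<le> p x"
begin

lemma sym: "A x y = A y x" and A_nonneg: "0 \<le> A x y" and A_le_1: "A x y \<le> 1"
  using kernel by (auto simp: sym_kernel_def)

abbreviation "D \<equiv> mass V p"
abbreviation "E \<equiv> edges V A p"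
abbreviation "T \<equiv> triangles V A p"
abbreviation "d x \<equiv> mass V (link A p x)"
abbreviation "t x \<equiv> edges V A (link A p x)"
abbreviation "c x y \<equiv> mass V (link A (link A p x) y)"

lemma link_nonneg: "0 \<le> link A p x y"
  by (simp add: link_def weight_nonneg A_nonneg)

lemma weighted_graph_link: "weighted_graph V A (link A p x)"
  using finite_V kernel link_nonneg by unfold_locales auto

lemma D_nonneg: "0 \<le> D" and d_nonneg: "0 \<le> d x"
  using A_nonneg by (auto intro!: mass_nonneg simp: weight_nonneg link_nonneg link_def)

lemma E_nonneg: "0 \<le> E"
  by (simp add: edges_def sum_nonneg weight_nonneg d_nonneg)

lemma t_nonneg: "0 \<le> t x"
  by (rule weighted_graph.E_nonneg[OF weighted_graph_link])

lemma T_nonneg: "0 \<le> T"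
  by (simp add: triangles_def sum_nonneg weight_nonneg t_nonneg)

section \<open>Weighted sums over ordered edges and triangles\<close>

definition pair_sum :: "('a \<Rightarrow> 'a \<Rightarrow> real) \<Rightarrow> real" where
  "pair_sum h = (\<Sum>x\<in>V. \<Sum>y\<in>V. p x * p y * A x y * h x y)"

definition tri_sum :: "('a \<Rightarrow> 'a \<Rightarrow> 'a \<Rightarrow> real) \<Rightarrow> real" where
  "tri_sum h = (\<Sum>x\<in>V. \<Sum>y\<in>V. \<Sum>z\<in>V. p x * p y * p z * A x y * A x z * A y z * h x y z)"

lemma pair_sum_add: "pair_sum (\<lambda>x y. f x y + g x y) = pair_sum f + pair_sum g"
  by (simp add: pair_sum_def sum.distrib algebra_simps)

lemma pair_sum_diff: "pair_sum (\<lambda>x y. f x y - g x y) = pair_sum f - pair_sum g"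
  by (simp add: pair_sum_def sum_subtractf algebra_simps)

lemma pair_sum_cmult: "pair_sum (\<lambda>x y. r * f x y) = r * pair_sum f"
  by (simp add: pair_sum_def sum_distrib_left algebra_simps)

lemma pair_sum_nonneg: "(\<And>x y. 0 \<le> f x y) \<Longrightarrow> 0 \<le> pair_sum f"
  by (simp add: pair_sum_def sum_nonneg weight_nonneg A_nonneg)

lemma pair_sum_swap: "pair_sum (\<lambda>x y. h y x) = pair_sum h"
  unfolding pair_sum_def by (subst sum.swap) (simp add: sym mult_ac)

lemma pair_sum_fst: "pair_sum (\<lambda>x y. h x) = (\<Sum>x\<in>V. p x * d x * h x)"
  by (simp add: pair_sum_def mass_def link_def sum_distrib_left sum_distrib_right mult_ac)

lemma pair_sum_snd: "pair_sum (\<lambda>x y. h y) = (\<Sum>x\<in>V. p x * d x * h x)"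
  using pair_sum_swap[of "\<lambda>x y. h x"] by (simp add: pair_sum_fst)

lemma pair_sum_const: "pair_sum (\<lambda>x y. r) = r * E"
  by (simp add: pair_sum_fst edges_def sum_distrib_left mult_ac)

lemma pair_sum_c: "pair_sum (\<lambda>x y. c x y * h x y) = tri_sum (\<lambda>x y z. h x y)"
  by (simp add: pair_sum_def tri_sum_def mass_def link_def sum_distrib_left
      sum_distrib_right mult_ac)

lemma tri_sum_swap12: "tri_sum (\<lambda>x y z. h y x z) = tri_sum h"
proof -
  have "tri_sum (\<lambda>x y z. h y x z) =
      (\<Sum>y\<in>V. \<Sum>x\<in>V. \<Sum>z\<in>V. p x * p y * p z * A x y * A x z * A y z * h y x z)"
    unfolding tri_sum_def by (rule sum.swap)
  also have "\<dots> = tri_sum h"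
    unfolding tri_sum_def
  proof (intro sum.cong refl)
    fix x y z
    show "p y * p x * p z * A y x * A y z * A x z * h x y z =
          p x * p y * p z * A x y * A x z * A y z * h x y z"
      by (simp add: sym[of y x] mult_ac)
  qed
  finally show ?thesis .
qed

lemma tri_sum_swap23: "tri_sum (\<lambda>x y z. h x z y) = tri_sum h"
  unfolding tri_sum_def
proof (rule sum.cong[OF refl])
  fix x
  have "(\<Sum>y\<in>V. \<Sum>z\<in>V. p x * p y * p z * A x y * A x z * A y z * h x z y) =
        (\<Sum>z\<in>V. \<Sum>y\<in>V. p x * p y * p z * A x y * A x z * A y z * h x z y)"
    by (rule sum.swap)
  also have "\<dots> = (\<Sum>y\<in>V. \<Sum>z\<in>V. p x * p y * p z * A x y * A x z * A y z * h x y z)"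
  proof (intro sum.cong refl)
    fix y z
    show "p x * p z * p y * A x z * A x y * A z y * h x y z =
          p x * p y * p z * A x y * A x z * A y z * h x y z"
      by (simp add: sym[of z y] mult_ac)
  qed
  finally show "(\<Sum>y\<in>V. \<Sum>z\<in>V. p x * p y * p z * A x y * A x z * A y z * h x z y) =
      (\<Sum>y\<in>V. \<Sum>z\<in>V. p x * p y * p z * A x y * A x z * A y z * h x y z)" .
qed

lemma tri_sum_fst: "tri_sum (\<lambda>x y z. h x) = (\<Sum>x\<in>V. p x * t x * h x)"
  by (simp add: tri_sum_def edges_def mass_def link_def sum_distrib_left sum_distrib_right mult_ac)

lemma tri_sum_const: "tri_sum (\<lambda>x y z. r) = r * T"
  by (simp add: tri_sum_fst triangles_def sum_distrib_left mult_ac)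

text \<open>The weight of the common non-neighbours of two vertices.\<close>
definition conon :: "'a \<Rightarrow> 'a \<Rightarrow> real" where
  "conon x y = D - d x - d y + c x y"

lemma conon_eq: "conon x y = (\<Sum>w\<in>V. p w * (1 - A x w) * (1 - A y w))"
  by (simp add: conon_def mass_def link_def sum_subtractf sum.distrib algebra_simps)

lemma conon_nonneg: "0 \<le> conon x y"
  unfolding conon_eq by (intro sum_nonneg mult_nonneg_nonneg) (auto simp: weight_nonneg A_le_1)

lemma conon_sym: "conon x y = conon y x"
  unfolding conon_eq by (simp add: mult_ac)

lemma conon_le: "conon x y \<le> D"
  unfolding conon_eq mass_def
proof (intro sum_mono)
  fix w
  have "(1 - A x w) * (1 - A y w) \<le> 1" using A_nonneg A_le_1 by (intro mult_le_one) auto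
  then show "p w * (1 - A x w) * (1 - A y w) \<le> p w"
    using weight_nonneg[of w] by (simp add: mult.assoc mult_left_le)
qed

section \<open>Goodman's inequality and the upper bound on 4-cliques\<close>

lemma goodman_sq: "2 * (\<Sum>x\<in>V. p x * (d x)^2) \<le> D * E + T"
proof -
  have "0 \<le> pair_sum conon" by (rule pair_sum_nonneg) (rule conon_nonneg)
  also have "pair_sum conon = pair_sum (\<lambda>x y. ((D - d x) - d y) + c x y * 1)"
    by (rule arg_cong[of _ _ pair_sum]) (simp add: fun_eq_iff conon_def)
  also have "\<dots> = D * E - 2 * (\<Sum>x\<in>V. p x * (d x)^2) + T"
    unfolding pair_sum_add pair_sum_diff pair_sum_const pair_sum_fst pair_sum_snd pair_sum_c
      tri_sum_const by (simp add: power2_eq_square mult_ac)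
  finally show ?thesis by simp
qed

lemma E_sq_le: "E^2 \<le> D * (\<Sum>x\<in>V. p x * (d x)^2)"
proof -
  have *: "sqrt (p x) * (sqrt (p x) * h) = p x * h" for x h
    using weight_nonneg[of x] by (simp add: mult.assoc[symmetric])
  have "(\<Sum>x\<in>V. sqrt (p x) * (sqrt (p x) * d x))\<^sup>2 \<le>
    (\<Sum>x\<in>V. (sqrt (p x))\<^sup>2) * (\<Sum>x\<in>V. (sqrt (p x) * d x)\<^sup>2)"
    by (rule Cauchy_Schwarz_ineq_sum)
  then show ?thesis
    unfolding * power_mult_distrib real_sqrt_pow2[OF weight_nonneg] edges_def mass_def[of V p] .
qed

text \<open>Cauchy-Schwarz eliminates the squared degrees. On mass 1 this is the parabola
  \<open>E * (2 * E - 1) \<le> T\<close>, which touches the extremal curve at the balanced complete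
  multipartite graphs.\<close>

lemma goodman: "2 * E^2 - D^2 * E \<le> D * T"
proof -
  have "2 * E^2 \<le> D * (2 * (\<Sum>x\<in>V. p x * (d x)^2))" using E_sq_le by simp
  also have "\<dots> \<le> D * (D * E + T)" by (rule mult_left_mono[OF goodman_sq D_nonneg])
  finally show ?thesis by (simp add: algebra_simps power2_eq_square)
qed

text \<open>The vertices adjacent to none of the three corners of a triangle have nonnegative
  weight. Expanding that weight gives mass minus degrees plus codegrees minus common neighbours. By
  symmetry the three degree terms agree, and so do the three codegree terms; summing
  \<open>c x y\<close> over the third corner produces one more factor \<open>c x y\<close>, hence
  the square.\<close>

lemma cliques4_le:
  "cliques4 V A p \<le> D * T - 3 * (\<Sum>x\<in>V. p x * t x * d x) + 3 * pair_sum (\<lambda>x y. (c x y)^2)"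
proof -
  \<comment> \<open>For a pair \<open>x\<close>, \<open>y\<close> this sums over the common
    neighbours \<open>z\<close> the weight of the vertices \<open>w\<close> that miss all of
    \<open>x\<close>, \<open>y\<close> and \<open>z\<close>.\<close>
  define R where "R x y = (\<Sum>z\<in>V. p z * A x z * A y z *
      (\<Sum>w\<in>V. p w * (1 - A x w) * (1 - A y w) * (1 - A z w)))" for x y
  have R0: "0 \<le> R x y" for x y
    unfolding R_def by (intro sum_nonneg mult_nonneg_nonneg)
      (auto simp: weight_nonneg A_le_1 A_nonneg)
  have R: "R x y = (\<Sum>z\<in>V. p z * A x z * A y z * (conon x y - d z + c x z + c y z)) -
      edges V A (link A (link A p x) y)" for x y
  proof -
    have "(\<Sum>w\<in>V. p w * (1 - A x w) * (1 - A y w) * (1 - A z w)) =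
        (conon x y - d z + c x z + c y z) - mass V (link A (link A (link A p x) y) z)" for z
      by (simp add: conon_def mass_def link_def sum_subtractf sum.distrib algebra_simps)
    moreover have "edges V A (link A (link A p x) y) =
        (\<Sum>z\<in>V. p z * A x z * A y z * mass V (link A (link A (link A p x) y) z))"
      by (subst edges_def) (simp add: link_def)
    ultimately show ?thesis
      by (simp only: R_def right_diff_distrib sum_subtractf)
  qed
  have "0 \<le> pair_sum R" by (rule pair_sum_nonneg) (rule R0)
  also have "pair_sum R = tri_sum (\<lambda>x y z. conon x y - d z + c x z + c y z) - cliques4 V A p"
  proof -
    have "pair_sum (\<lambda>x y. edges V A (link A (link A p x) y)) = cliques4 V A p"
      by (simp add: pair_sum_def cliques4_def triangles_def link_def[of A p] sum_distrib_left mult_ac)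
    moreover have "pair_sum (\<lambda>x y. \<Sum>z\<in>V. p z * A x z * A y z * (conon x y - d z + c x z + c y z))
        = tri_sum (\<lambda>x y z. conon x y - d z + c x z + c y z)"
      by (simp add: pair_sum_def tri_sum_def sum_distrib_left mult_ac)
    ultimately show ?thesis unfolding R by (simp add: pair_sum_diff)
  qed
  also have "tri_sum (\<lambda>x y z. conon x y - d z + c x z + c y z) =
      tri_sum (\<lambda>x y z. conon x y) - tri_sum (\<lambda>x y z. d z) + tri_sum (\<lambda>x y z. c x z)
        + tri_sum (\<lambda>x y z. c y z)"
    by (simp add: tri_sum_def sum.distrib sum_subtractf algebra_simps)
  also have "tri_sum (\<lambda>x y z. conon x y) =
      tri_sum (\<lambda>x y z. D) - tri_sum (\<lambda>x y z. d x) - tri_sum (\<lambda>x y z. d y) + tri_sum (\<lambda>x y z. c x y)"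
    by (simp add: conon_def tri_sum_def sum.distrib sum_subtractf algebra_simps)
  also have "tri_sum (\<lambda>x y z. d y) = tri_sum (\<lambda>x y z. d x)"
    by (rule tri_sum_swap12)
  also have "tri_sum (\<lambda>x y z. d z) = tri_sum (\<lambda>x y z. d x)"
    using tri_sum_swap23[of "\<lambda>x y z. d y"] tri_sum_swap12[of "\<lambda>x y z. d x"] by simp
  also have "tri_sum (\<lambda>x y z. c x z) = tri_sum (\<lambda>x y z. c x y)"
    by (rule tri_sum_swap23)
  also have "tri_sum (\<lambda>x y z. c y z) = tri_sum (\<lambda>x y z. c x y)"
    using tri_sum_swap12[of "\<lambda>x y z. c x z"] tri_sum_swap23[of "\<lambda>x y z. c x y"] by simp
  also have "tri_sum (\<lambda>x y z. c x y) = pair_sum (\<lambda>x y. (c x y)^2)"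
    using pair_sum_c[of c] by (simp add: power2_eq_square)
  finally show ?thesis by (simp add: tri_sum_const tri_sum_fst)
qed

end

subsection \<open>Triangles and 4-cliques at a stationary point\<close>

text \<open>Razborov's inequality for edge densities up to that of the balanced complete \<open>m\<close>-partite graph,
  scaled so that the big parts of the extremal graph have weight 1. The bound is then linear in the
  mass along the curve \<open>E = 2 (m - 1) D - m (m - 1)\<close>, hence linear in the degrees when applied to
  links.\<close>
definition razborov_bound :: "'a set \<Rightarrow> real \<Rightarrow> bool" where
  "razborov_bound V m \<longleftrightarrow> (\<forall>A p. weighted_graph V A p \<longrightarrow> mass V p \<le> m \<longrightarrow>
     2 * (m - 1) * mass V p - m * (m - 1) \<le> edges V A p \<longrightarrow>
     (m - 1) * (m - 2) * (3 * mass V p - 2 * m) \<le> triangles V A p)"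

context weighted_graph
begin

lemma weighted_graph_scale: "0 \<le> r \<Longrightarrow> weighted_graph V A (\<lambda>x. r * p x)"
  using finite_V kernel weight_nonneg by unfold_locales auto

text \<open>Mass, edge weight and triangle weight are homogeneous of degree 1, 2 and 3; dividing the
  weights by the size \<open>b\<close> of a big part reduces to the normalised bound.\<close>

lemma razborov_bound_scaled:
  assumes "razborov_bound V m" "0 < b" "D \<le> m * b"
    and "2 * (m - 1) * b * D - m * (m - 1) * b^2 \<le> E"
  shows "(m - 1) * (m - 2) * b^2 * (3 * D - 2 * m * b) \<le> T"
proof -
  have b: "b > 0" by fact
  have "D / b \<le> m" using assms(2,3) by (simp add: field_simps)
  moreover have "2 * (m - 1) * (D / b) - m * (m - 1) \<le> E / b^2"
  proof -
    have "2 * (m - 1) * (D / b) - m * (m - 1) = (2 * (m - 1) * b * D - m * (m - 1) * b^2) / b^2"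
      using b by (simp add: field_simps power2_eq_square)
    also have "\<dots> \<le> E / b^2" using assms(4) b by (intro divide_right_mono) auto
    finally show ?thesis .
  qed
  ultimately have "(m - 1) * (m - 2) * (3 * (D / b) - 2 * m) \<le> T / b^3"
    using assms(1)[unfolded razborov_bound_def, rule_format, OF weighted_graph_scale[of "1/b"]] b
    unfolding mass_scale edges_scale triangles_scale by (simp add: power_divide)
  then have "(m - 1) * (m - 2) * (3 * (D / b) - 2 * m) * b^3 \<le> T" using b by (simp add: field_simps)
  also have "(m - 1) * (m - 2) * (3 * (D / b) - 2 * m) * b^3 =
      (m - 1) * (m - 2) * b^2 * (3 * D - 2 * m * b)"
    using b by (simp add: field_simps power2_eq_square power3_eq_cube)
  finally show ?thesis .
qed

text \<open>For links of mass at least \<open>m\<close>, Goodman's inequality is enough once the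
  codegree condition \<open>E \<le> (m - 1) * D\<close> is known. The deficit splits as
  \<open>\<theta> = (m - 1) * v + \<rho>\<close>, with \<open>v\<close> the excess mass and
  \<open>\<rho>\<close> the slack in that condition.\<close>

lemma triangles_ge_large:
  assumes m: "2 \<le> m" and D: "m \<le> D" and E: "E \<le> (m - 1) * D"
    and \<theta>: "E = 2 * (m - 1) * D - m * (m - 1) - \<theta>"
  shows "(m - 1) * (m - 2) * (3 * D - 2 * m) - (4 * m - 6) * \<theta> \<le> T"
proof -
  define v where "v = D - m"
  define \<rho> where "\<rho> = (m - 1) * D - E"
  have v: "v \<ge> 0" "D = m + v" and \<rho>: "\<rho> \<ge> 0" "E = (m - 1) * D - \<rho>"
    using D E by (auto simp: v_def \<rho>_def)
  have \<theta>': "\<theta> = (m - 1) * v + \<rho>" using \<theta> \<rho> v by (simp add: algebra_simps)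
  have goal: "(m - 1) * (m - 2) * (3 * D - 2 * m) - (4 * m - 6) * \<theta> =
      (m - 1) * m * (m - 2 - v) - (4 * m - 6) * \<rho>"
    unfolding \<theta>' v(2) by (simp add: algebra_simps)
  show ?thesis
  \<comment> \<open>For larger \<open>v\<close> the claimed lower bound is at most 0.\<close>
  proof (cases "v \<ge> m - 2")
    case True
    have "(m - 1) * m * (m - 2 - v) \<le> 0" using True m by (intro mult_nonneg_nonpos) auto
    moreover have "(4 * m - 6) * \<rho> \<ge> 0" using m \<rho> by simp
    ultimately show ?thesis using T_nonneg goal by linarith
  next
    case False
    have Dp: "D > 0" using m D by linarith
    \<comment> \<open>Goodman's left side at \<open>E = (m - 1) * D - \<rho>\<close>, without its
      square term \<open>2 * \<rho>^2\<close>.\<close>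
    have "D * ((m - 1) * D * (2 * (m - 1) - D) - \<rho> * (4 * (m - 1) - D)) \<le>
        2 * E^2 - D^2 * E"
    proof -
      have "2 * E^2 - D^2 * E - D * ((m - 1) * D * (2 * (m - 1) - D) - \<rho> * (4 * (m - 1) - D))
          = 2 * \<rho>^2"
        unfolding \<rho>(2) by (simp add: algebra_simps power2_eq_square)
      moreover have "0 \<le> 2 * \<rho>^2" by simp
      ultimately show ?thesis by linarith
    qed
    also have "\<dots> \<le> D * T" by (rule goodman)
    finally have *: "(m - 1) * D * (2 * (m - 1) - D) - \<rho> * (4 * (m - 1) - D) \<le> T"
      using Dp by simp
    have "((m - 1) * D * (2 * (m - 1) - D) - \<rho> * (4 * (m - 1) - D)) -
       ((m - 1) * m * (m - 2 - v) - (4 * m - 6) * \<rho>) = (m - 1) * v * (m - 2 - v) + \<rho> * (D - 2)"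
      unfolding v(2) by (simp add: algebra_simps)
    moreover have "0 \<le> (m - 1) * v * (m - 2 - v)" using False m v by simp
    moreover have "0 \<le> \<rho> * (D - 2)" using \<rho> D m by simp
    ultimately show ?thesis using * goal by linarith
  qed
qed

text \<open>A link with too few edges for unit parts lies exactly on the extremal curve for parts of
  some size \<open>b > 1\<close>. The induction hypothesis at scale \<open>b\<close> is then
  compared with the linear bound.\<close>

lemma triangles_ge_small:
  assumes bound: "razborov_bound V m" and m: "2 \<le> m" and D: "D < m" and \<theta>: "0 < \<theta>"
    and E: "E = 2 * (m - 1) * D - m * (m - 1) - \<theta>"
  shows "(m - 1) * (m - 2) * (3 * D - 2 * m) - (4 * m - 6) * \<theta> \<le> T"
proof -
  define r where "r = sqrt ((m - D)^2 + m * \<theta> / (m - 1))"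
  \<comment> \<open>\<open>b\<close> is the larger root of \<open>m (m - 1) b\<^sup>2 - 2 (m - 1) D b + E = 0\<close>\<close>
  define b where "b = (D + r) / m"
  \<comment> \<open>\<open>\<beta>\<close> is the excess of a big part over 1. Since
    \<open>D - (m - 1) * b = b - w\<close>, the number \<open>w\<close> is what the remaining part
    lacks to full size \<open>b\<close>.\<close>
  define \<beta> where "\<beta> = b - 1"
  define w where "w = r"
  have pos: "0 < m * \<theta> / (m - 1)" using m \<theta> by simp
  then have r2: "r^2 = (m - D)^2 + m * \<theta> / (m - 1)"
    unfolding r_def by (intro real_sqrt_pow2) (simp add: add_nonneg_nonneg less_imp_le)
  have "m - D < r" unfolding r_def using pos by (intro real_less_rsqrt) simp
  then have \<beta>: "\<beta> > 0" and w: "w > 0" using m D by (auto simp: \<beta>_def b_def w_def field_simps)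
  have mb: "m * (1 + \<beta>) = D + w" using m by (simp add: \<beta>_def b_def w_def)
  then have Dw: "D = m * (1 + \<beta>) - w" by simp
  have w_gt: "w > m * \<beta>" using Dw D by (simp add: algebra_simps)
  have \<theta>_eq: "\<theta> = (m - 1) * \<beta> * (2 * w - m * \<beta>)"
  proof -
    have "m * \<theta> = (m - 1) * (r^2 - (m - D)^2)" using r2 m by (simp add: field_simps)
    also have "\<dots> = (m - 1) * (w^2 - (w - m * \<beta>)^2)" unfolding Dw w_def by (simp add: algebra_simps)
    also have "\<dots> = m * ((m - 1) * \<beta> * (2 * w - m * \<beta>))"
      by (simp add: algebra_simps power2_eq_square)
    finally show ?thesis using m by simp
  qed
  show ?thesis
  \<comment> \<open>Up to 1/2 the difference of the two bounds is visibly nonnegative; beyond it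
    \<open>\<theta>\<close> exceeds \<open>m * (m - 1) / 4\<close>, which already pushes the claimed
    bound down to 0 or below.\<close>
  proof (cases "\<beta> \<le> 1/2")
    case True
    have E_eq: "2 * (m - 1) * b * D - m * (m - 1) * b^2 = E"
      unfolding E \<theta>_eq Dw \<beta>_def by (simp add: algebra_simps power2_eq_square)
    have low: "(m - 1) * (m - 2) * b^2 * (3 * D - 2 * m * b) \<le> T"
    proof (rule razborov_bound_scaled[OF bound])
      show "0 < b" using \<beta> by (simp add: \<beta>_def)
      show "D \<le> m * b" using mb w by (simp add: \<beta>_def)
      show "2 * (m - 1) * b * D - m * (m - 1) * b\<^sup>2 \<le> E" using E_eq by simp
    qed
    have b: "b = 1 + \<beta>" by (simp add: \<beta>_def)
    have "(m - 1) * (m - 2) * b^2 * (3 * D - 2 * m * b) -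
        ((m - 1) * (m - 2) * (3 * D - 2 * m) - (4 * m - 6) * \<theta>) =
        (m - 1) * \<beta> * ((w - m * \<beta>) * (2 * m - 3 * (m - 2) * \<beta>) + m * \<beta> * (m - 2 * (m - 2) * \<beta>))"
      unfolding \<theta>_eq Dw b by (simp add: algebra_simps power2_eq_square power3_eq_cube)
    moreover have "0 \<le> (m - 1) * \<beta> * ((w - m * \<beta>) * (2 * m - 3 * (m - 2) * \<beta>)
        + m * \<beta> * (m - 2 * (m - 2) * \<beta>))"
    proof -
      have "(m - 2) * \<beta> \<le> (m - 2) * (1/2)" using m True by (intro mult_left_mono) auto
      then have "3 * ((m - 2) * \<beta>) \<le> 2 * m" and "2 * ((m - 2) * \<beta>) \<le> m"
        using m by auto
      then have "0 \<le> 2 * m - 3 * (m - 2) * \<beta>" "0 \<le> m - 2 * (m - 2) * \<beta>"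
        by (simp_all only: mult.assoc diff_ge_0_iff_ge)
      then show ?thesis using m \<beta> w_gt by simp
    qed
    ultimately show ?thesis using low by linarith
  next
    case False
    have "3 * D - 2 * m \<le> m" using D by simp
    then have "(m - 1) * (m - 2) * (3 * D - 2 * m) \<le> (m - 1) * (m - 2) * m"
      using m by (intro mult_left_mono) auto
    also have "\<dots> \<le> (4 * m - 6) * \<theta>"
    proof -
      have "m / 4 \<le> \<beta> * (m * \<beta>)"
      proof -
        have "(1/2) * (1/2) \<le> \<beta> * \<beta>" using False by (intro mult_mono) auto
        then have "m * ((1/2) * (1/2)) \<le> m * (\<beta> * \<beta>)" using m by (intro mult_left_mono) auto
        then show ?thesis by (simp add: mult_ac)
      qed
      also have "\<dots> \<le> \<beta> * (2 * w - m * \<beta>)"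
        using w_gt \<beta> by (intro mult_left_mono) (auto simp: mult.commute)
      finally have "(m - 1) * (m / 4) \<le> \<theta>"
        unfolding \<theta>_eq mult.assoc using m by (intro mult_left_mono) auto
      then have "(4 * m - 6) * ((m - 1) * (m / 4)) \<le> (4 * m - 6) * \<theta>"
        using m by (intro mult_left_mono) auto
      moreover have "(m - 1) * (m - 2) * m \<le> (4 * m - 6) * ((m - 1) * (m / 4))"
      proof -
        have "(4 * m - 6) * ((m - 1) * (m / 4)) - (m - 1) * (m - 2) * m = (m - 1) * m / 2"
          by (simp add: field_simps)
        then show ?thesis using m by (smt (verit) divide_nonneg_nonneg mult_nonneg_nonneg)
      qed
      ultimately show ?thesis by linarith
    qed
    finally show ?thesis using T_nonneg by linarith
  qed
qed

text \<open>The hypothesis \<open>pairs\<close> is the codegree bound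
  \<open>c x y \<le> m - 1\<close> on edges, averaged against \<open>conon\<close>. It supplies the
  upper bound on the sum of squared codegrees that \<open>cliques4_le\<close> requires. Weighting by
  \<open>conon\<close> costs nothing at the extremal graph, where \<open>conon\<close> vanishes on
  edges.\<close>

lemma stationary_contradiction:
  assumes bound: "razborov_bound V m" and m: "2 \<le> m" and D: "m < D" "D \<le> m + 1"
    and \<theta>: "0 < \<theta>" and E: "E = 2 * m * D - m * (m + 1)"
    and t: "\<And>x. x \<in> V \<Longrightarrow> p x > 0 \<Longrightarrow> t x = 2 * (m - 1) * d x - m * (m - 1) - \<theta>"
    and td: "\<And>x. x \<in> V \<Longrightarrow> p x > 0 \<Longrightarrow> t x \<le> (m - 1) * d x"
    and pairs: "0 \<le> pair_sum (\<lambda>x y. conon x y * ((m - 1) - c x y))"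
  shows False
proof -
  define C where "C = m * (m - 1) + \<theta>"
  define q where "q = (\<Sum>x\<in>V. p x * (d x)^2)"
  have t': "p x * t x = p x * (2 * (m - 1) * d x - C)" if "x \<in> V" for x
    using t[OF that] weight_nonneg[of x] by (cases "p x = 0") (auto simp: C_def)
  have T: "T = 2 * (m - 1) * E - C * D"
  proof -
    have "T = (\<Sum>x\<in>V. p x * (2 * (m - 1) * d x - C))"
      unfolding triangles_def using t' by (rule sum.cong[OF refl])
    also have "\<dots> = 2 * (m - 1) * E - C * D"
      by (simp add: edges_def mass_def[of V p] sum_distrib_left sum_subtractf sum.distrib algebra_simps)
    finally show ?thesis .
  qed
  have td_sum: "(\<Sum>x\<in>V. p x * t x * d x) = 2 * (m - 1) * q - C * E"
  proof -
    have "(\<Sum>x\<in>V. p x * t x * d x) = (\<Sum>x\<in>V. p x * (2 * (m - 1) * d x - C) * d x)"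
      using t' by (intro sum.cong) auto
    also have "\<dots> = 2 * (m - 1) * q - C * E"
      by (simp add: q_def edges_def sum_distrib_left sum_subtractf sum.distrib algebra_simps
          power2_eq_square)
    finally show ?thesis .
  qed
  define Q where "Q = pair_sum (\<lambda>x y. (c x y)^2)"
  have pairs': "pair_sum (\<lambda>x y. conon x y * ((m - 1) - c x y)) =
      (m - 1) * (D * E - 2 * q + T) - (D * T - 2 * (\<Sum>x\<in>V. p x * t x * d x) + Q)"
  proof -
    have "pair_sum (\<lambda>x y. conon x y * ((m - 1) - c x y)) =
        pair_sum (\<lambda>x y. ((m - 1) * (((D - d x) - d y) + c x y * 1))
          - ((c x y * D - c x y * d x - c x y * d y) + (c x y)^2))"
      by (rule arg_cong[of _ _ pair_sum])
         (simp add: fun_eq_iff conon_def algebra_simps power2_eq_square)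
    also have "\<dots> = (m - 1) * (D * E - 2 * q + T)
        - (D * T - 2 * (\<Sum>x\<in>V. p x * t x * d x) + Q)"
      using tri_sum_swap12[of "\<lambda>x y z. d x"]
      unfolding pair_sum_add pair_sum_diff pair_sum_const pair_sum_fst pair_sum_snd pair_sum_c
        tri_sum_const pair_sum_cmult Q_def q_def
      by (simp add: tri_sum_fst power2_eq_square mult_ac)
    finally show ?thesis .
  qed
  \<comment> \<open>The squared degrees \<open>q\<close> cancel: they enter with coefficient
    \<open>6 * (m - 1)\<close> through \<open>td_sum\<close> and with its negative through
    \<open>pairs'\<close>.\<close>
  have upper: "cliques4 V A p \<le> - 2 * D * T - 3 * C * E + 3 * (m - 1) * (T + D * E)"
    using cliques4_le pairs unfolding pairs' td_sum Q_def[symmetric] by (simp add: algebra_simps)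
  have link_ge: "p x * ((m - 1) * (m - 2) * (3 * d x - 2 * m) - (4 * m - 6) * \<theta>) \<le>
      p x * triangles V A (link A p x)" if x: "x \<in> V" for x
  proof (cases "p x = 0")
    case False
    then have px: "p x > 0" using weight_nonneg[of x] by simp
    have "(m - 1) * (m - 2) * (3 * d x - 2 * m) - (4 * m - 6) * \<theta> \<le> triangles V A (link A p x)"
    proof (cases "d x < m")
      case True
      show ?thesis
        by (rule weighted_graph.triangles_ge_small[OF weighted_graph_link bound m True \<theta> t[OF x px]])
    next
      case False
      then show ?thesis
        by (intro weighted_graph.triangles_ge_large[OF weighted_graph_link m _ td[OF x px] t[OF x px]])
           simp
    qed
    then show ?thesis using px by simp
  qed simp
  have "(m - 1) * (m - 2) * (3 * E - 2 * m * D) - (4 * m - 6) * \<theta> * D =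
     (\<Sum>x\<in>V. p x * ((m - 1) * (m - 2) * (3 * d x - 2 * m) - (4 * m - 6) * \<theta>))"
  proof -
    have "(\<Sum>x\<in>V. p x * (\<alpha> * (3 * d x - 2 * m) - \<kappa>)) =
        (\<Sum>x\<in>V. (3 * \<alpha>) * (p x * d x) - (2 * \<alpha> * m + \<kappa>) * p x)" for \<alpha> \<kappa>
      by (intro sum.cong) (simp_all add: algebra_simps)
    moreover have "(\<Sum>x\<in>V. (3 * \<alpha>) * (p x * d x) - (2 * \<alpha> * m + \<kappa>) * p x) = 3 * \<alpha> * E - (2 * \<alpha> * m + \<kappa>) * D" for \<alpha> \<kappa>
      by (simp add: edges_def mass_def[of V p] sum_subtractf sum_distrib_left[symmetric])
    ultimately have sum_eq: "(\<Sum>x\<in>V. p x * (\<alpha> * (3 * d x - 2 * m) - \<kappa>)) =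
        3 * \<alpha> * E - (2 * \<alpha> * m + \<kappa>) * D" for \<alpha> \<kappa>
      by presburger
    show ?thesis unfolding sum_eq by (simp add: algebra_simps)
  qed
  also have "\<dots> \<le> cliques4 V A p"
    unfolding cliques4_def by (rule sum_mono) (rule link_ge)
  finally have "(m - 1) * (m - 2) * (3 * E - 2 * m * D) - (4 * m - 6) * \<theta> * D \<le>
     - 2 * D * T - 3 * C * E + 3 * (m - 1) * (T + D * E)" using upper by linarith
  \<comment> \<open>At \<open>\<theta> = 0\<close> the two bounds coincide; the difference is
    exactly linear in the deficit.\<close>
  moreover have "(m - 1) * (m - 2) * (3 * E - 2 * m * D) - (4 * m - 6) * \<theta> * D -
     (- 2 * D * T - 3 * C * E + 3 * (m - 1) * (T + D * E)) = \<theta> * ((D - m) * (3 * (m + 1) - 2 * D))"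
    unfolding T C_def E by (simp add: algebra_simps power2_eq_square power3_eq_cube)
  moreover have "0 < \<theta> * ((D - m) * (3 * (m + 1) - 2 * D))"
    using \<theta> D m by (intro mult_pos_pos) auto
  ultimately show False by linarith
qed

text \<open>Up to mass \<open>m\<close> the linear bound for \<open>m + 1\<close> parts lies below
  Goodman's, with contact at \<open>D = m\<close>: for \<open>E = F\<close> the gap after
  multiplication by \<open>D\<close> is \<open>2 * m * u * (1 + u)^2\<close>.\<close>

lemma triangles_ge_goodman:
  assumes m: "1 \<le> m" and D: "D \<le> m" and E: "2 * m * D - m * (m + 1) \<le> E"
  shows "m * (m - 1) * (3 * D - 2 * (m + 1)) \<le> T"
proof (cases "3 * D - 2 * (m + 1) \<le> 0")
  case True
  then have "m * (m - 1) * (3 * D - 2 * (m + 1)) \<le> 0" using m by (intro mult_nonneg_nonpos) auto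
  then show ?thesis using T_nonneg by linarith
next
  case False
  define u where "u = m - D"
  define F where "F = 2 * m * D - m * (m + 1)"
  have D_eq: "D = m - u" and u: "u \<ge> 0" using D by (auto simp: u_def)
  have Dpos: "D > 0" using False m by auto
  have F: "F > 0"
  proof -
    have "3 * D > 2 * m + 2" using False by (simp add: algebra_simps)
    then have "2 * D - (m + 1) > 0" using m by linarith
    then have "m * (2 * D - (m + 1)) > 0" using m by simp
    then show ?thesis by (simp add: F_def algebra_simps)
  qed
  have "F * (2 * F - D^2) - D * (m * (m - 1) * (3 * D - 2 * (m + 1))) = m * (2 * u * (1 + u)^2)"
    unfolding F_def D_eq by (simp add: algebra_simps power2_eq_square power3_eq_cube)
  moreover have "m * (2 * u * (1 + u)^2) \<ge> 0" using m u by simp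
  ultimately have 1: "D * (m * (m - 1) * (3 * D - 2 * (m + 1))) \<le> F * (2 * F - D^2)" by linarith
  moreover have "0 \<le> D * (m * (m - 1) * (3 * D - 2 * (m + 1)))"
    using False m Dpos by simp
  ultimately have "2 * F - D^2 \<ge> 0" using F by (smt (verit) mult_pos_neg)
  \<comment> \<open>Both factors are nonnegative and increase with the edge weight, so replacing
    \<open>F\<close> by the actual \<open>E\<close> only helps.\<close>
  then have "F * (2 * F - D^2) \<le> E * (2 * E - D^2)"
    using E F by (intro mult_mono) (auto simp: F_def)
  also have "\<dots> \<le> D * T" using goodman by (simp add: algebra_simps power2_eq_square)
  finally show ?thesis using 1 Dpos by (meson mult_le_cancel_left_pos order_trans)
qed

end

subsection \<open>Existence of minimisers and stationarity\<close>

lemma edges_eq: "edges V A p = (\<Sum>x\<in>V. \<Sum>y\<in>V. p x * p y * A x y)"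
  by (simp add: edges_def mass_def link_def sum_distrib_left mult_ac)

lemma triangles_eq:
  "triangles V A p = (\<Sum>x\<in>V. \<Sum>y\<in>V. \<Sum>z\<in>V. p x * p y * p z * A x y * A x z * A y z)"
  by (simp add: triangles_def edges_def mass_def link_def sum_distrib_left mult_ac)

section \<open>First variations in the weights and in the kernel\<close>

context weighted_graph
begin

text \<open>The perturbation is multiplicative, so zero weights stay zero and, for small
  \<open>s\<close>, all weights stay nonnegative.\<close>

lemma DERIV_edges_weight:
  "((\<lambda>s. edges V A (\<lambda>x. p x * (1 + s * u x))) has_real_derivative
     2 * (\<Sum>x\<in>V. p x * d x * u x)) (at 0)"
proof -
  have "((\<lambda>s. edges V A (\<lambda>x. p x * (1 + s * u x))) has_real_derivative
     pair_sum (\<lambda>x y. u x + u y)) (at 0)"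
    unfolding edges_eq pair_sum_def
    by (auto intro!: derivative_eq_intros sum.cong simp: algebra_simps)
  then show ?thesis by (simp add: pair_sum_add pair_sum_fst pair_sum_snd)
qed

lemma DERIV_triangles_weight:
  "((\<lambda>s. triangles V A (\<lambda>x. p x * (1 + s * u x))) has_real_derivative
     3 * (\<Sum>x\<in>V. p x * t x * u x)) (at 0)"
proof -
  have "((\<lambda>s. triangles V A (\<lambda>x. p x * (1 + s * u x))) has_real_derivative
     tri_sum (\<lambda>x y z. u x + u y + u z)) (at 0)"
    unfolding triangles_eq tri_sum_def
    by (auto intro!: derivative_eq_intros sum.cong simp: algebra_simps)
  moreover have "tri_sum (\<lambda>x y z. u x + u y + u z) =
      tri_sum (\<lambda>x y z. u x) + tri_sum (\<lambda>x y z. u y) + tri_sum (\<lambda>x y z. u z)"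
    by (simp add: tri_sum_def sum.distrib algebra_simps)
  ultimately show ?thesis
    using tri_sum_swap12[of "\<lambda>x y z. u x"] tri_sum_swap23[of "\<lambda>x y z. u y"]
    by (simp add: tri_sum_fst)
qed

lemma DERIV_edges_kernel:
  "((\<lambda>s. edges V (\<lambda>x y. A x y * (1 - s * w x y)) p) has_real_derivative - pair_sum w) (at 0)"
  unfolding edges_eq pair_sum_def
  by (auto intro!: derivative_eq_intros sum.cong simp: algebra_simps sum_negf)

text \<open>Scaling entries down by \<open>1 - s * w x y\<close> keeps them in [0,1] only for small
  \<open>s \<ge> 0\<close> when \<open>w\<close> is nonnegative; hence the kernel yields one-sided
  conditions, in contrast to the two-sided use of the weights.\<close>

lemma DERIV_triangles_kernel:
  assumes "\<And>x y. w x y = w y x"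
  shows "((\<lambda>s. triangles V (\<lambda>x y. A x y * (1 - s * w x y)) p) has_real_derivative
     - 3 * pair_sum (\<lambda>x y. c x y * w x y)) (at 0)"
proof -
  have "((\<lambda>s. triangles V (\<lambda>x y. A x y * (1 - s * w x y)) p) has_real_derivative
     - tri_sum (\<lambda>x y z. w x y + w x z + w y z)) (at 0)"
    unfolding triangles_eq tri_sum_def
    by (auto intro!: derivative_eq_intros sum.cong simp: algebra_simps sum_negf[symmetric])
  moreover have "tri_sum (\<lambda>x y z. w x y + w x z + w y z) =
      tri_sum (\<lambda>x y z. w x y) + tri_sum (\<lambda>x y z. w x z) + tri_sum (\<lambda>x y z. w y z)"
    by (simp add: tri_sum_def sum.distrib algebra_simps)
  moreover have "tri_sum (\<lambda>x y z. w y z) = tri_sum (\<lambda>x y z. w x z)"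
    using tri_sum_swap12[of "\<lambda>x y z. w x z"] by simp
  ultimately show ?thesis
    using tri_sum_swap23[of "\<lambda>x y z. w x y"] by (simp add: pair_sum_c)
qed

end

section \<open>Compactness and continuity on the space of weights and kernels\<close>

lemma compact_functions:
  fixes S :: "'b::topological_space set"
  assumes "compact S"
  shows "compact {f :: 'a \<Rightarrow> 'b. \<forall>x. f x \<in> S}"
proof -
  have "{f :: 'a \<Rightarrow> 'b. \<forall>x. f x \<in> S} = (\<Pi>\<^sub>E x\<in>UNIV. S)" by auto
  moreover have "compactin (product_topology (\<lambda>x::'a. euclidean) UNIV) (\<Pi>\<^sub>E x\<in>UNIV. S)"
    using assms by (simp add: compactin_PiE)
  ultimately show ?thesis by (simp add: euclidean_product_topology)
qed

lemma continuous_on_weight: "continuous_on UNIV (\<lambda>z::('a \<Rightarrow> real) \<times> ('a \<Rightarrow> 'a \<Rightarrow> real). fst z x)"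
  by (rule continuous_on_product_then_coordinatewise[OF continuous_on_fst[OF continuous_on_id]])

lemma continuous_on_kernel:
  "continuous_on UNIV (\<lambda>z::('a \<Rightarrow> real) \<times> ('a \<Rightarrow> 'a \<Rightarrow> real). snd z x y)"
  by (rule continuous_on_product_then_coordinatewise[OF
        continuous_on_product_then_coordinatewise[OF continuous_on_snd[OF continuous_on_id]]])

lemma continuous_on_mass:
  "continuous_on UNIV (\<lambda>z::('a \<Rightarrow> real) \<times> ('a \<Rightarrow> 'a \<Rightarrow> real). mass V (fst z))"
  unfolding mass_def by (intro continuous_intros continuous_on_weight)

lemma continuous_on_edges:
  "continuous_on UNIV (\<lambda>z::('a \<Rightarrow> real) \<times> ('a \<Rightarrow> 'a \<Rightarrow> real). edges V (snd z) (fst z))"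
  unfolding edges_eq by (intro continuous_intros continuous_on_weight continuous_on_kernel)

lemma continuous_on_triangles:
  "continuous_on UNIV (\<lambda>z::('a \<Rightarrow> real) \<times> ('a \<Rightarrow> 'a \<Rightarrow> real). triangles V (snd z) (fst z))"
  unfolding triangles_eq by (intro continuous_intros continuous_on_weight continuous_on_kernel)

text \<open>Weights and kernels are functions on the whole type, so their values off
  \<open>V\<close> are confined to [0,1] too; Tychonoff's theorem then applies. Bounding the edge
  weight by closed conditions keeps the set closed.\<close>

definition weight_kernel_pairs ::
    "'a set \<Rightarrow> real \<Rightarrow> real \<Rightarrow> (('a \<Rightarrow> real) \<times> ('a \<Rightarrow> 'a \<Rightarrow> real)) set" where
  "weight_kernel_pairs V lo hi = {z. (\<forall>x. fst z x \<in> {0..1}) \<and> (\<forall>x y. snd z x y \<in> {0..1}) \<and>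
     (\<forall>x y. snd z x y = snd z y x) \<and> mass V (fst z) = 1 \<and>
     lo \<le> edges V (snd z) (fst z) \<and> edges V (snd z) (fst z) \<le> hi}"

lemma compact_weight_kernel_pairs: "compact (weight_kernel_pairs V lo hi)"
proof -
  let ?B = "{z::('a \<Rightarrow> real) \<times> ('a \<Rightarrow> 'a \<Rightarrow> real). (\<forall>x. fst z x \<in> {0..1}) \<and> (\<forall>x y. snd z x y \<in> {0..1})}"
  have "?B = {p. \<forall>x. p x \<in> {0..1}} \<times> {A. \<forall>x. A x \<in> {q. \<forall>y. q y \<in> {0..1}}}" by auto
  then have "compact ?B"
    by (simp only: compact_Times[OF compact_functions[OF compact_Icc]
          compact_functions[OF compact_functions[OF compact_Icc]]])
  moreover have "closed {z::('a \<Rightarrow> real) \<times> ('a \<Rightarrow> 'a \<Rightarrow> real). (\<forall>x y. snd z x y = snd z y x) \<and>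
      mass V (fst z) = 1 \<and> lo \<le> edges V (snd z) (fst z) \<and> edges V (snd z) (fst z) \<le> hi}"
    by (intro closed_Collect_conj closed_Collect_all closed_Collect_eq closed_Collect_le
        continuous_on_const continuous_on_kernel continuous_on_mass continuous_on_edges)
  ultimately have "compact (?B \<inter> {z. (\<forall>x y. snd z x y = snd z y x) \<and>
      mass V (fst z) = 1 \<and> lo \<le> edges V (snd z) (fst z) \<and> edges V (snd z) (fst z) \<le> hi})"
    by (rule compact_Int_closed)
  moreover have "weight_kernel_pairs V lo hi = ?B \<inter> {z. (\<forall>x y. snd z x y = snd z y x) \<and>
      mass V (fst z) = 1 \<and> lo \<le> edges V (snd z) (fst z) \<and> edges V (snd z) (fst z) \<le> hi}"
    by (auto simp: weight_kernel_pairs_def)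
  ultimately show ?thesis by simp
qed

text \<open>The complete \<open>(m+1)\<close>-partite graph with \<open>m\<close> parts of size \<open>part_size m e\<close> and one smaller
  part has edge density \<open>e\<close> and triangle density \<open>scallop m e\<close>.\<close>

definition part_size :: "real \<Rightarrow> real \<Rightarrow> real" where
  "part_size m e = (1 + sqrt (1 - (m + 1) * e / m)) / (m + 1)"

definition scallop :: "real \<Rightarrow> real \<Rightarrow> real" where
  "scallop m e = m * (m - 1) * (part_size m e)^2 * (3 - 2 * (m + 1) * part_size m e)"

lemma part_size_quadratic:
  assumes "0 < m" "e \<le> m / (m + 1)"
  shows "2 * m * part_size m e - m * (m + 1) * (part_size m e)^2 = e"
proof -
  define r where "r = sqrt (1 - (m + 1) * e / m)"
  have "(m + 1) * e / m \<le> 1" using assms by (simp add: field_simps)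
  then have r2: "r^2 = 1 - (m + 1) * e / m" by (simp add: r_def)
  have a: "part_size m e = (1 + r) / (m + 1)" by (simp add: part_size_def r_def)
  have aM: "(m + 1) * part_size m e = 1 + r" using assms by (simp add: a)
  have "(m + 1) * (2 * m * part_size m e - m * (m + 1) * (part_size m e)^2) =
      m * ((m + 1) * part_size m e) * (2 - (m + 1) * part_size m e)"
    by (simp add: algebra_simps power2_eq_square)
  also have "\<dots> = m * (1 - r^2)" unfolding aM by (simp add: algebra_simps power2_eq_square)
  also have "\<dots> = (m + 1) * e" unfolding r2 using assms by (simp add: field_simps)
  finally show ?thesis using assms by simp
qed

text \<open>The two roots of the quadratic lie symmetrically about \<open>1 / (m + 1)\<close>; the
  second hypothesis selects the larger one.\<close>

lemma part_size_of_quadratic: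
  assumes "0 < m" "1 / (m + 1) \<le> a" "2 * m * a - m * (m + 1) * a^2 = e"
  shows "part_size m e = a"
proof -
  have "e / m = 2 * a - (m + 1) * a^2"
    unfolding assms(3)[symmetric] using assms(1) by (simp add: diff_divide_distrib)
  then have "(m + 1) * e / m = (m + 1) * (2 * a - (m + 1) * a^2)"
    by (simp only: times_divide_eq_right[symmetric])
  then have "1 - (m + 1) * e / m = ((m + 1) * a - 1)^2"
    by (simp add: algebra_simps power2_eq_square)
  moreover have "(m + 1) * a - 1 \<ge> 0" using assms by (simp add: field_simps)
  ultimately show ?thesis using assms by (simp add: part_size_def)
qed

text \<open>In the extremal graph an edge between the small part and a big one has as common
  neighbours the other \<open>m - 1\<close> big parts. Lowering such edges changes triangle weight
  against edge weight at the rate of three times this codegree, which is the slope found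
  here.\<close>

lemma DERIV_scallop:
  assumes "0 < m" "e < m / (m + 1)"
  shows "(scallop m has_real_derivative 3 * (m - 1) * part_size m e) (at e)"
proof -
  define r where "r = sqrt (1 - (m + 1) * e / m)"
  have pos: "1 - (m + 1) * e / m > 0" using assms by (simp add: field_simps)
  then have r: "r > 0" by (simp add: r_def)
  have a: "part_size m e = (1 + r) / (m + 1)" by (simp add: part_size_def r_def)
  have m1: "m + 1 > 0" using assms by simp
  define \<delta> where "\<delta> = - 1 / (2 * m * r)"
  have D: "(part_size m has_real_derivative \<delta>) (at e)"
  proof -
    have "((\<lambda>e. 1 - (m + 1) * e / m) has_real_derivative - (m + 1) / m) (at e)"
      using assms(1) by (auto intro!: derivative_eq_intros simp: field_simps)
    from DERIV_chain2[OF DERIV_real_sqrt[OF pos] this]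
    have "((\<lambda>e. sqrt (1 - (m + 1) * e / m)) has_real_derivative
        inverse r / 2 * (- (m + 1) / m)) (at e)" by (simp add: r_def)
    then have "((\<lambda>e. (1 + sqrt (1 - (m + 1) * e / m)) / (m + 1)) has_real_derivative
        (0 + inverse r / 2 * (- (m + 1) / m)) / (m + 1)) (at e)"
      by (intro DERIV_cdivide DERIV_add DERIV_const)
    moreover have "(0 + inverse r / 2 * (- (m + 1) / m)) / (m + 1) = \<delta>"
      unfolding \<delta>_def using m1 assms(1) r by (simp add: divide_simps)
    ultimately show ?thesis by (simp add: part_size_def[abs_def])
  qed
  have "(scallop m has_real_derivative
      m * (m - 1) * (6 * part_size m e - 6 * (m + 1) * (part_size m e)^2) * \<delta>) (at e)"
    unfolding scallop_def[abs_def]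
    by (rule derivative_eq_intros refl D)+ (simp add: algebra_simps power2_eq_square)
  also have "m * (m - 1) * (6 * part_size m e - 6 * (m + 1) * (part_size m e)^2) * \<delta>
      = 3 * (m - 1) * part_size m e"
  proof -
    have eq: "6 * part_size m e - 6 * (m + 1) * (part_size m e)^2 = - 6 * part_size m e * r"
    proof -
      have aM: "(m + 1) * part_size m e = 1 + r" using m1 by (simp add: a)
      have "6 * part_size m e - 6 * (m + 1) * (part_size m e)^2 =
          6 * part_size m e * (1 - (m + 1) * part_size m e)"
        by (simp add: algebra_simps power2_eq_square)
      then show ?thesis unfolding aM by simp
    qed
    show ?thesis unfolding eq \<delta>_def using r assms by (simp add: field_simps)
  qed
  finally show ?thesis .
qed

lemma continuous_on_scallop: "0 < m \<Longrightarrow> continuous_on S (scallop m)"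
  unfolding scallop_def[abs_def] part_size_def by (intro continuous_intros) auto

lemma DERIV_right_min_nonneg:
  fixes f :: "real \<Rightarrow> real"
  assumes "(f has_real_derivative l) (at 0)" "eventually (\<lambda>s. f 0 \<le> f s) (at_right 0)"
  shows "0 \<le> l"
proof (rule ccontr)
  assume "\<not> 0 \<le> l"
  then obtain \<delta> where \<delta>: "\<delta> > 0" "\<And>h. h > 0 \<Longrightarrow> h < \<delta> \<Longrightarrow> f h < f 0"
    using DERIV_neg_dec_right[OF assms(1)] by auto
  obtain b where b: "b > 0" "\<And>s. 0 < s \<Longrightarrow> s < b \<Longrightarrow> f 0 \<le> f s"
    using assms(2) unfolding eventually_at_right_field by auto
  show False using \<delta>(2)[of "min \<delta> b / 2"] b(2)[of "min \<delta> b / 2"] \<delta>(1) b(1) by linarith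
qed

section \<open>Stationarity at an interior minimiser\<close>

context weighted_graph
begin

text \<open>Minimality is tested on the open edge interval only, where \<open>scallop m\<close> is
  differentiable and which small perturbations do not leave. Competitors agree with \<open>p\<close>
  off \<open>V\<close>, so that the compact set from which the minimiser comes contains
  them.\<close>

lemma scallop_minimiser_False:
  assumes bound: "razborov_bound V m" and m: "2 \<le> m" and D1: "D = 1"
    and E: "1 - 1/m < E" "E < m / (m + 1)" and T: "T < scallop m E"
    and minimal: "\<And>A' p'. weighted_graph V A' p' \<Longrightarrow> mass V p' = 1 \<Longrightarrow>
      (\<And>x. x \<notin> V \<Longrightarrow> p' x = p x) \<Longrightarrow>
      1 - 1/m < edges V A' p' \<Longrightarrow> edges V A' p' < m / (m + 1) \<Longrightarrow>
      T - scallop m E \<le> triangles V A' p' - scallop m (edges V A' p')"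
  shows False
proof -
  define a where "a = part_size m E"
  \<comment> \<open>The codegree of a big-small edge in the extremal graph;
    \<open>3 * \<gamma>\<close> is the Lagrange multiplier of the edge weight.\<close>
  define \<gamma> where "\<gamma> = (m - 1) * a"
  have quad: "2 * m * a - m * (m + 1) * a^2 = E"
    unfolding a_def using m E by (intro part_size_quadratic) auto
  have a_ge: "a \<ge> 1 / (m + 1)" using m E
    by (auto simp: a_def part_size_def divide_right_mono field_simps)
  then have a_pos: "a > 0" using m by (smt (verit) divide_pos_pos)
  have a_lt: "a < 1 / m"
  proof (rule ccontr)
    assume "\<not> a < 1/m"
    then have am: "m * a \<ge> 1" using m by (simp add: field_simps)
    have "E = 1 - 1/m - (m * a - 1) * ((m + 1) * a - (1 - 1/m))"
      unfolding quad[symmetric] using m by (simp add: field_simps power2_eq_square)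
    moreover have "(m + 1) * a \<ge> 1" using a_ge m by (simp add: field_simps)
    moreover have "1 / m > 0" using m by simp
    ultimately show False using E(1) am
      by (smt (verit) mult_nonneg_nonneg)
  qed
  have dscallop: "(scallop m has_real_derivative 3 * \<gamma>) (at E)"
  proof -
    have "3 * \<gamma> = 3 * (m - 1) * part_size m E" by (simp add: \<gamma>_def a_def)
    then show ?thesis using m E by (simp only: DERIV_scallop)
  qed
  \<comment> \<open>First-order condition along any curve of competitors defined for small
    \<open>s > 0\<close>.\<close>
  have descent: "0 \<le> \<tau>' - 3 * \<gamma> * \<epsilon>'"
    if \<tau>: "(\<tau> has_real_derivative \<tau>') (at 0)" and \<epsilon>: "(\<epsilon> has_real_derivative \<epsilon>') (at 0)"
      and at0: "\<tau> 0 = T" "\<epsilon> 0 = E"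
      and adm: "eventually (\<lambda>s. 1 - 1/m < \<epsilon> s \<longrightarrow> \<epsilon> s < m / (m + 1) \<longrightarrow>
          T - scallop m E \<le> \<tau> s - scallop m (\<epsilon> s)) (at_right 0)"
    for \<tau> \<epsilon> :: "real \<Rightarrow> real" and \<tau>' \<epsilon>'
  proof (rule DERIV_right_min_nonneg)
    show "((\<lambda>s. \<tau> s - scallop m (\<epsilon> s)) has_real_derivative \<tau>' - 3 * \<gamma> * \<epsilon>') (at 0)"
      using DERIV_diff[OF \<tau> DERIV_chain2[where f = "scallop m" and g = \<epsilon>, OF _ \<epsilon>]] dscallop at0
      by simp
    have "(\<epsilon> \<longlongrightarrow> \<epsilon> 0) (at 0)" using DERIV_isCont[OF \<epsilon>] by (simp add: isCont_def)
    then have "(\<epsilon> \<longlongrightarrow> \<epsilon> 0) (at_right 0)" by (rule tendsto_mono[OF at_le[OF subset_UNIV]])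
    then have "eventually (\<lambda>s. 1 - 1/m < \<epsilon> s) (at_right 0)" "eventually (\<lambda>s. \<epsilon> s < m / (m + 1)) (at_right 0)"
      using E at0 by (auto intro: order_tendstoD)
    with adm show "eventually (\<lambda>s. \<tau> 0 - scallop m (\<epsilon> 0) \<le> \<tau> s - scallop m (\<epsilon> s)) (at_right 0)"
      by eventually_elim (use at0 in auto)
  qed
  have pairs: "0 \<le> pair_sum (\<lambda>x y. w x y * (\<gamma> - c x y))"
    if w: "\<And>x y. w x y = w y x" "\<And>x y. 0 \<le> w x y" "\<And>x y. w x y \<le> B" for w B
  proof -
    have "0 \<le> - 3 * pair_sum (\<lambda>x y. c x y * w x y) - 3 * \<gamma> * (- pair_sum w)"
    proof (rule descent[OF DERIV_triangles_kernel[OF w(1)] DERIV_edges_kernel])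
      have "eventually (\<lambda>s. 0 < s \<and> s < 1 / (\<bar>B\<bar> + 1)) (at_right (0::real))"
        by (intro eventually_conj eventually_at_right_less eventually_at_right_real)
          (auto intro!: eventually_at_rightI[of 0 "1 / (\<bar>B\<bar> + 1)"])
      then show "eventually (\<lambda>s. 1 - 1/m < edges V (\<lambda>x y. A x y * (1 - s * w x y)) p \<longrightarrow>
          edges V (\<lambda>x y. A x y * (1 - s * w x y)) p < m / (m + 1) \<longrightarrow>
          T - scallop m E \<le> triangles V (\<lambda>x y. A x y * (1 - s * w x y)) p
            - scallop m (edges V (\<lambda>x y. A x y * (1 - s * w x y)) p)) (at_right 0)"
      proof eventually_elim
        case (elim s)
        have sw: "0 \<le> s * w x y" "s * w x y \<le> 1" for x y
        proof -
          show "0 \<le> s * w x y" using elim w(2) by simp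
          have "s * w x y \<le> 1 / (\<bar>B\<bar> + 1) * (\<bar>B\<bar> + 1)"
            using elim w(2)[of x y] w(3)[of x y] by (intro mult_mono) auto
          also have "\<dots> = 1" by (simp add: add_nonneg_eq_0_iff)
          finally show "s * w x y \<le> 1" .
        qed
        have "weighted_graph V (\<lambda>x y. A x y * (1 - s * w x y)) p"
        proof
          show "sym_kernel (\<lambda>x y. A x y * (1 - s * w x y))"
            unfolding sym_kernel_def using sw w(1) sym A_nonneg A_le_1
            by (auto intro!: mult_le_one)
        qed (use finite_V weight_nonneg in auto)
        then show ?case using minimal D1 by blast
      qed
    qed simp_all
    moreover have "pair_sum (\<lambda>x y. w x y * (\<gamma> - c x y)) = \<gamma> * pair_sum w - pair_sum (\<lambda>x y. c x y * w x y)"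
      by (simp add: pair_sum_cmult[symmetric] pair_sum_diff[symmetric] algebra_simps)
    ultimately show ?thesis by simp
  qed
  have t: "t x = 2 * \<gamma> * d x + (T - 2 * \<gamma> * E)" if x: "x \<in> V" "p x > 0" for x
  proof -
    define h where "h x = 3 * t x - 6 * \<gamma> * d x" for x
    define hm where "hm = 3 * T - 6 * \<gamma> * E"
    \<comment> \<open>Steepest descent direction of the first variation \<open>h\<close>, centred so
      that total mass is preserved. Along it the derivative is minus the variance of
      \<open>h\<close>, so \<open>h\<close> is constant where \<open>p\<close> is positive. The
      value 0 off \<open>V\<close> keeps the weights there unchanged.\<close>
    define u where "u x = (if x \<in> V then hm - h x else 0)" for x
    have hm: "(\<Sum>x\<in>V. p x * h x) = hm"
      by (simp add: h_def hm_def triangles_def edges_def[of V A p] sum_distrib_left sum_subtractf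
          right_diff_distrib mult_ac)
    have pu: "(\<Sum>x\<in>V. p x * u x) = 0"
    proof -
      have "(\<Sum>x\<in>V. p x * u x) = (\<Sum>x\<in>V. p x * hm - p x * h x)"
        by (intro sum.cong) (auto simp: u_def algebra_simps)
      also have "\<dots> = D * hm - hm" by (simp add: sum_subtractf hm mass_def sum_distrib_right)
      finally show ?thesis using D1 by simp
    qed
    have "0 \<le> 3 * (\<Sum>x\<in>V. p x * t x * u x) - 3 * \<gamma> * (2 * (\<Sum>x\<in>V. p x * d x * u x))"
    proof (rule descent[OF DERIV_triangles_weight DERIV_edges_weight])
      have "eventually (\<lambda>s. 0 < 1 + s * u x) (at_right 0)" for x
      proof -
        have "((\<lambda>s. 1 + s * u x) \<longlongrightarrow> 1 + 0 * u x) (at_right 0)" by (intro tendsto_intros)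
        then show ?thesis by (rule order_tendstoD) simp
      qed
      then have "eventually (\<lambda>s. \<forall>x\<in>V. 0 < 1 + s * u x) (at_right 0)"
        using finite_V by (simp add: eventually_ball_finite)
      then show "eventually (\<lambda>s. 1 - 1/m < edges V A (\<lambda>x. p x * (1 + s * u x)) \<longrightarrow>
          edges V A (\<lambda>x. p x * (1 + s * u x)) < m / (m + 1) \<longrightarrow>
          T - scallop m E \<le> triangles V A (\<lambda>x. p x * (1 + s * u x))
            - scallop m (edges V A (\<lambda>x. p x * (1 + s * u x)))) (at_right 0)"
      proof eventually_elim
        case (elim s)
        have "0 \<le> 1 + s * u x" for x
          using elim by (cases "x \<in> V") (auto simp: u_def[of x] less_imp_le)
        then have "weighted_graph V A (\<lambda>x. p x * (1 + s * u x))"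
          using finite_V kernel weight_nonneg by unfold_locales auto
        moreover have "mass V (\<lambda>x. p x * (1 + s * u x)) = 1"
          using D1 pu by (simp add: mass_def algebra_simps sum.distrib sum_distrib_left[symmetric])
        moreover have "\<And>x. x \<notin> V \<Longrightarrow> p x * (1 + s * u x) = p x" by (simp add: u_def)
        ultimately show ?case using minimal by blast
      qed
    qed simp_all
    also have "3 * (\<Sum>x\<in>V. p x * t x * u x) - 3 * \<gamma> * (2 * (\<Sum>x\<in>V. p x * d x * u x)) =
        (\<Sum>x\<in>V. p x * h x * u x)"
      by (simp add: h_def sum_distrib_left sum_subtractf algebra_simps)
    also have "\<dots> = (\<Sum>x\<in>V. hm * (p x * u x) - p x * (u x)^2)"
      by (intro sum.cong) (auto simp: u_def algebra_simps power2_eq_square)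
    also have "\<dots> = - (\<Sum>x\<in>V. p x * (u x)^2)"
      by (simp add: sum_subtractf sum_distrib_left[symmetric] pu)
    finally have "(\<Sum>x\<in>V. p x * (u x)^2) \<le> 0" by simp
    then have "(\<Sum>x\<in>V. p x * (u x)^2) = 0"
      by (intro antisym sum_nonneg) (auto simp: weight_nonneg)
    then have "p x * (u x)^2 = 0"
      using x(1) finite_V weight_nonneg by (subst (asm) sum_nonneg_eq_0_iff) auto
    then show ?thesis using x by (simp add: u_def h_def hm_def)
  qed
  have td: "t x \<le> \<gamma> * d x" if x: "x \<in> V" "p x > 0" for x
  proof -
    have "p y * h y * of_bool (y = x) = (if y = x then p y * h y else 0)" for y h by simp
    then have delta: "(\<Sum>y\<in>V. p y * h y * of_bool (y = x)) = p x * h x" for h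
      using x finite_V by (simp only: sum.delta if_True)
    \<comment> \<open>All edges at \<open>x\<close> are weakened at once; the weight is 2 on the
      pair \<open>(x, x)\<close>, which explains \<open>B = 2\<close>.\<close>
    have "0 \<le> pair_sum (\<lambda>y z. (of_bool (y = x) + of_bool (z = x)) * (\<gamma> - c y z))"
      by (rule pairs[where B = 2]) (auto simp: of_bool_def)
    also have "\<dots> = pair_sum (\<lambda>y z. \<gamma> * (of_bool (y = x) + of_bool (z = x))
        - (c y z * of_bool (y = x) + c y z * of_bool (z = x)))"
      by (rule arg_cong[of _ _ pair_sum]) (simp add: fun_eq_iff algebra_simps)
    also have "\<dots> = \<gamma> * (2 * (\<Sum>y\<in>V. p y * d y * of_bool (y = x))) -
        2 * (\<Sum>y\<in>V. p y * t y * of_bool (y = x))"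
      using tri_sum_swap12[of "\<lambda>y z v. of_bool (y = x)"]
      by (simp add: pair_sum_diff pair_sum_cmult pair_sum_add pair_sum_fst pair_sum_snd
          pair_sum_c tri_sum_fst)
    also have "\<dots> = 2 * p x * (\<gamma> * d x - t x)"
      unfolding delta by (simp add: algebra_simps)
    finally show ?thesis using x by (simp add: zero_le_mult_iff)
  qed
  \<comment> \<open>Rescaling by \<open>r\<close> gives the big parts of the extremal graph weight
    1.\<close>
  define r where "r = 1 / a"
  have r: "r > 0" "r * a = 1" using a_pos by (auto simp: r_def)
  interpret scaled: weighted_graph V A "\<lambda>x. r * p x"
    using r by (intro weighted_graph_scale) simp
  \<comment> \<open>The assumed violation of the scallop bound becomes the common deficit of all
    links.\<close>
  define \<theta> where "\<theta> = r^2 * (scallop m E - T)"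
  have rE: "r^2 * E = 2 * m * r - m * (m + 1)"
    unfolding quad[symmetric] r_def using a_pos by (simp add: field_simps power2_eq_square)
  have \<theta>_eq: "r^2 * (T - 2 * \<gamma> * E) = - m * (m - 1) - \<theta>"
  proof -
    have "scallop m E - 2 * \<gamma> * E = - m * (m - 1) * a^2"
    proof -
      have sc: "scallop m E = m * (m - 1) * a^2 * (3 - 2 * (m + 1) * a)"
        by (simp add: scallop_def a_def)
      show ?thesis unfolding sc unfolding \<gamma>_def quad[symmetric]
        by (simp add: algebra_simps power2_eq_square power3_eq_cube)
    qed
    then have "r^2 * (scallop m E - 2 * \<gamma> * E) = - m * (m - 1) * (r * a)^2"
      by (simp add: power_mult_distrib)
    then show ?thesis unfolding \<theta>_def r(2) by (simp add: algebra_simps)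
  qed
  have r\<gamma>: "r * \<gamma> = m - 1" using r(2) by (simp add: \<gamma>_def)
  show False
  proof (rule scaled.stationary_contradiction[OF bound m, of \<theta>])
    show "m < mass V (\<lambda>x. r * p x)" "mass V (\<lambda>x. r * p x) \<le> m + 1"
      unfolding mass_scale D1 r_def using a_lt a_ge a_pos m by (auto simp: field_simps)
    show "0 < \<theta>" using T r by (simp add: \<theta>_def)
    show "edges V A (\<lambda>x. r * p x) = 2 * m * mass V (\<lambda>x. r * p x) - m * (m + 1)"
      by (simp add: edges_scale mass_scale D1 rE)
    show "edges V A (link A (\<lambda>x. r * p x) x) =
        2 * (m - 1) * mass V (link A (\<lambda>x. r * p x) x) - m * (m - 1) - \<theta>"
      if "x \<in> V" "0 < r * p x" for x
    proof -
      have "edges V A (link A (\<lambda>x. r * p x) x) = r^2 * t x" by (simp add: link_scale edges_scale)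
      also have "\<dots> = 2 * (r * \<gamma>) * (r * d x) + r^2 * (T - 2 * \<gamma> * E)"
      proof -
        have "p x > 0" using that r by (simp add: zero_less_mult_iff)
        show ?thesis unfolding t[OF that(1) \<open>p x > 0\<close>] by (simp add: algebra_simps power2_eq_square)
      qed
      finally show ?thesis by (simp add: \<theta>_eq r\<gamma> link_scale mass_scale)
    qed
    show "edges V A (link A (\<lambda>x. r * p x) x) \<le> (m - 1) * mass V (link A (\<lambda>x. r * p x) x)"
      if "x \<in> V" "0 < r * p x" for x
    proof -
      have "r^2 * t x \<le> r^2 * (\<gamma> * d x)"
        using td[of x] that r by (intro mult_left_mono) (auto simp: zero_less_mult_iff)
      also have "\<dots> = (r * \<gamma>) * (r * d x)" by (simp add: power2_eq_square)
      finally show ?thesis by (simp add: r\<gamma> link_scale edges_scale mass_scale)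
    qed
    have "0 \<le> pair_sum (\<lambda>x y. conon x y * (\<gamma> - c x y))"
      by (rule pairs[where B = D]) (auto simp: conon_sym conon_nonneg conon_le)
    then have "0 \<le> r^4 * pair_sum (\<lambda>x y. conon x y * (\<gamma> - c x y))" using r by simp
    also have "\<dots> = scaled.pair_sum (\<lambda>x y. scaled.conon x y *
        (m - 1 - mass V (link A (link A (\<lambda>x. r * p x) x) y)))"
    proof -
      have l: "link A (\<lambda>y. r * link A p x y) y = (\<lambda>z. r * link A (link A p x) y z)" for x y
        by (rule link_scale)
      have cs: "scaled.conon x y = r * conon x y" for x y
        by (simp add: scaled.conon_def conon_def link_scale l mass_scale algebra_simps)
      have "scaled.pair_sum (\<lambda>x y. scaled.conon x y *
          (m - 1 - mass V (link A (link A (\<lambda>x. r * p x) x) y))) =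
        (\<Sum>x\<in>V. \<Sum>y\<in>V. r^4 * (p x * p y * A x y * (conon x y * (\<gamma> - c x y))))"
        unfolding scaled.pair_sum_def cs r\<gamma>[symmetric]
        by (intro sum.cong) (simp_all add: link_scale l mass_scale algebra_simps power4_eq_xxxx)
      then show ?thesis by (simp add: pair_sum_def sum_distrib_left)
    qed
    finally show "0 \<le> scaled.pair_sum (\<lambda>x y. scaled.conon x y *
        (m - 1 - mass V (link A (link A (\<lambda>x. r * p x) x) y)))" .
  qed
qed

end

lemma scallop_le_triangles:
  assumes bound: "razborov_bound V m" and m: "2 \<le> m" and G: "weighted_graph V A p"
    and D: "mass V p = 1" and E: "1 - 1/m \<le> edges V A p" "edges V A p \<le> m / (m + 1)"
  shows "scallop m (edges V A p) \<le> triangles V A p"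
proof (rule ccontr)
  assume less: "\<not> scallop m (edges V A p) \<le> triangles V A p"
  interpret weighted_graph V A p by fact
  let ?K = "weight_kernel_pairs V (1 - 1/m) (m / (m + 1))"
  let ?f = "\<lambda>z. triangles V (snd z) (fst z) - scallop m (edges V (snd z) (fst z))"
  have cont: "continuous_on ?K ?f"
    using m by (intro continuous_on_diff continuous_on_compose2[OF continuous_on_scallop[of _ UNIV]]
        continuous_on_subset[OF continuous_on_triangles] continuous_on_subset[OF continuous_on_edges]) auto
  \<comment> \<open>Weights off \<open>V\<close> are arbitrary and could exceed 1; setting them to 0
    places the given graph in the compact set without changing its densities.\<close>
  define p0 where "p0 x = (if x \<in> V then p x else 0)" for x
  have p0: "mass V p0 = mass V p" "edges V A p0 = edges V A p" "triangles V A p0 = triangles V A p"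
    by (auto simp: p0_def mass_def edges_eq triangles_eq intro!: sum.cong)
  have "p x \<le> mass V p" if "x \<in> V" for x
    unfolding mass_def using that finite_V weight_nonneg by (intro member_le_sum) auto
  then have p0_mem: "(p0, A) \<in> ?K"
    using D E p0 weight_nonneg A_nonneg A_le_1 sym
    by (auto simp: weight_kernel_pairs_def p0_def)
  then have "?K \<noteq> {}" by blast
  from continuous_attains_inf[OF compact_weight_kernel_pairs this cont]
  obtain z where z: "z \<in> ?K" and zmin: "\<And>y. y \<in> ?K \<Longrightarrow> ?f z \<le> ?f y" by blast
  obtain q B where zq: "z = (q, B)" by (cases z)
  have qB: "weighted_graph V B q" "mass V q = 1" "\<And>x. q x \<le> 1"
    and EB: "1 - 1/m \<le> edges V B q" "edges V B q \<le> m / (m + 1)"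
    using z finite_V unfolding zq weight_kernel_pairs_def
    by (auto simp: weighted_graph_def sym_kernel_def)
  interpret Q: weighted_graph V B q by fact
  have neg: "triangles V B q < scallop m (edges V B q)"
    using zmin[OF p0_mem] less p0 by (simp add: zq)
  have goodman_Q: "edges V B q * (2 * edges V B q - 1) \<le> triangles V B q"
    using Q.goodman qB(2) by (simp add: power2_eq_square algebra_simps)
  \<comment> \<open>At each end of the interval the scallop takes the value
    \<open>e * (2 * e - 1)\<close> of Goodman's parabola, so a violation can only occur in the
    interior.\<close>
  have "edges V B q \<noteq> 1 - 1/m"
  proof
    assume e: "edges V B q = 1 - 1/m"
    have "part_size m (1 - 1/m) = 1/m"
    proof (rule part_size_of_quadratic)
      show "0 < m" "1 / (m + 1) \<le> 1 / m" using m by (auto simp: field_simps)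
      have "m * (1/m) = 1" using m by simp
      then show "2 * m * (1/m) - m * (m + 1) * (1/m)^2 = 1 - 1/m"
        using m by (simp add: power2_eq_square add_divide_distrib)
    qed
    then have "scallop m (edges V B q) = (m * (1/m)) * (m - 1) * (1/m) * (3 - 2 * (m + 1) * (1/m))"
      by (simp only: e scallop_def power2_eq_square mult_ac)
    also have "\<dots> = (1 - 1/m) * (2 * (1 - 1/m) - 1)"
    proof -
      have "(m - 1) * (1/m) = 1 - 1/m" "2 * (m + 1) * (1/m) = 2 + 2 * (1/m)"
        using m by (auto simp: field_simps)
      then show ?thesis using m by (simp only: mult.assoc) simp
    qed
    finally have "scallop m (edges V B q) = (1 - 1/m) * (2 * (1 - 1/m) - 1)" .
    then show False using goodman_Q[unfolded e] neg by linarith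
  qed
  moreover have "edges V B q \<noteq> m / (m + 1)"
  proof
    assume e: "edges V B q = m / (m + 1)"
    have b: "(m + 1) * (1 / (m + 1)) = 1" using m by simp
    have e': "m / (m + 1) = m * (1 / (m + 1))" "1 / (m + 1) * m = 1 - 1 / (m + 1)"
      using m by (simp_all add: field_simps)
    have "part_size m (m / (m + 1)) = 1/(m + 1)"
    proof (rule part_size_of_quadratic)
      have "m * (m + 1) * (1 / (m + 1))^2 = m * ((m + 1) * (1 / (m + 1))) * (1 / (m + 1))"
        by (simp only: power2_eq_square mult_ac)
      then show "2 * m * (1 / (m + 1)) - m * (m + 1) * (1 / (m + 1))^2 = m / (m + 1)"
        unfolding b by simp
    qed (use m in auto)
    then have "scallop m (edges V B q) =
        m / (m + 1) * ((m - 1) * (1 / (m + 1)) * (3 - 2 * ((m + 1) * (1 / (m + 1)))))"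
      by (simp only: e scallop_def power2_eq_square e' mult_ac)
    also have "\<dots> = m / (m + 1) * (2 * (m / (m + 1)) - 1)"
      unfolding b using m by (simp add: field_simps)
    finally have "scallop m (edges V B q) = m / (m + 1) * (2 * (m / (m + 1)) - 1)" .
    then show False using goodman_Q[unfolded e] neg by linarith
  qed
  ultimately have EB': "1 - 1/m < edges V B q" "edges V B q < m / (m + 1)" using EB by auto
  show False
  proof (rule Q.scallop_minimiser_False[OF bound m qB(2) EB' neg])
    fix A' p'
    assume G': "weighted_graph V A' p'" and *: "mass V p' = 1" "\<And>x. x \<notin> V \<Longrightarrow> p' x = q x"
      "1 - 1/m < edges V A' p'" "edges V A' p' < m / (m + 1)"
    interpret G': weighted_graph V A' p' by fact
    have "p' x \<le> 1" for x
    proof (cases "x \<in> V")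
      case True
      then have "p' x \<le> mass V p'"
        unfolding mass_def using finite_V G'.weight_nonneg by (intro member_le_sum) auto
      then show ?thesis using * by simp
    qed (use * qB in auto)
    then have "(p', A') \<in> ?K"
      using * G'.weight_nonneg G'.A_nonneg G'.A_le_1 G'.sym
      by (auto simp: weight_kernel_pairs_def)
    from zmin[OF this] show "triangles V B q - scallop m (edges V B q) \<le>
        triangles V A' p' - scallop m (edges V A' p')" by (simp add: zq)
  qed
qed

text \<open>Goodman's inequality settles mass up to \<open>m\<close>. For mass in
  \<open>(m, m + 1]\<close>, normalising to mass 1 puts the edge threshold \<open>e\<close> inside
  the range of the scallop for \<open>m\<close>, and \<open>1 / D\<close> is precisely its part
  size.\<close>

lemma razborov_bound_step:
  assumes bound: "razborov_bound V m" and m: "2 \<le> m"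
  shows "razborov_bound V (m + 1)"
  unfolding razborov_bound_def
proof (intro allI impI)
  fix A p
  assume G: "weighted_graph V A p" and D: "mass V p \<le> m + 1"
    and E: "2 * (m + 1 - 1) * mass V p - (m + 1) * (m + 1 - 1) \<le> edges V A p"
  interpret weighted_graph V A p by fact
  have E': "2 * m * D - m * (m + 1) \<le> E" using E by (simp add: algebra_simps)
  have "m * (m - 1) * (3 * D - 2 * (m + 1)) \<le> T"
  proof (cases "D \<le> m")
    case True
    then show ?thesis using m E' by (intro triangles_ge_goodman) auto
  next
    case False
    define a where "a = 1 / D"
    define e where "e = 2 * m * a - m * (m + 1) * a^2"
    have Dpos: "D > 0" and aD: "a * D = 1" and a: "a > 0" using False m by (auto simp: a_def)
    have a_ge: "1 / (m + 1) \<le> a" using D Dpos m by (simp add: a_def field_simps)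
    have e_eq: "e = a^2 * (2 * m * D - m * (m + 1))"
    proof -
      have "e = 2 * m * a * (a * D) - m * (m + 1) * a^2" by (simp add: e_def aD)
      then show ?thesis by (simp add: algebra_simps power2_eq_square)
    qed
    have size: "part_size m e = a"
      using m a_ge by (intro part_size_of_quadratic) (auto simp: e_def)
    have e_low: "1 - 1/m \<le> e"
    proof -
      have "m * a \<le> 1" using False m by (simp add: a_def field_simps)
      moreover have "(m + 1) * a \<ge> 1" using a_ge m by (simp add: field_simps)
      moreover have "0 < 1 / m" using m by simp
      ultimately have "0 \<le> 1 - m * a" and "0 \<le> (m + 1) * a - (1 - 1/m)" by linarith+
      then have "0 \<le> (1 - m * a) * ((m + 1) * a - (1 - 1/m))" by (rule mult_nonneg_nonneg)
      also have "\<dots> = e - (1 - 1/m)"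
        unfolding e_def using m by (simp add: field_simps power2_eq_square)
      finally show ?thesis by simp
    qed
    have e_high: "e \<le> m / (m + 1)"
    proof -
      have "(m + 1) * e = m - m * ((m + 1) * a - 1)^2"
        unfolding e_def by (simp add: algebra_simps power2_eq_square)
      also have "\<dots> \<le> m" using m by simp
      finally show ?thesis using m by (simp add: field_simps)
    qed
    have e_pos: "e > 0" using e_low m by (smt (verit) divide_less_eq_1_pos)
    have aE: "e \<le> a^2 * E" unfolding e_eq using E' by (intro mult_left_mono) auto
    \<comment> \<open>The edge weight is only known to be at least the threshold. Shrinking the
      whole kernel by \<open>s\<close> makes it equal, while triangles shrink by
      \<open>s^3 \<le> 1\<close>.\<close>
    define s where "s = e / (a^2 * E)"
    have s: "0 \<le> s" "s \<le> 1" "a^2 * (s * E) = e" using aE e_pos by (auto simp: s_def)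
    have "weighted_graph V (\<lambda>x y. s * A x y) (\<lambda>x. a * p x)"
      using finite_V weight_nonneg a kernel_scale[OF kernel s(1,2)] by unfold_locales auto
    then have "scallop m (edges V (\<lambda>x y. s * A x y) (\<lambda>x. a * p x)) \<le>
        triangles V (\<lambda>x y. s * A x y) (\<lambda>x. a * p x)"
      by (intro scallop_le_triangles[OF bound m])
        (simp_all add: mass_scale edges_scale edges_scale_kernel aD s e_low e_high)
    then have "scallop m e \<le> a^3 * (s^3 * T)"
      by (simp add: edges_scale edges_scale_kernel triangles_scale triangles_scale_kernel s)
    also have "\<dots> \<le> a^3 * T"
      using s a T_nonneg by (intro mult_left_mono) (auto simp: power_le_one mult_left_le_one_le)
    finally have "m * (m - 1) * a^2 * (3 - 2 * (m + 1) * a) \<le> a^3 * T"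
      by (simp add: scallop_def size)
    also have "m * (m - 1) * a^2 * (3 - 2 * (m + 1) * a) =
        a^3 * (m * (m - 1) * (3 * D - 2 * (m + 1)))"
    proof -
      have "a^3 * (m * (m - 1) * (3 * D - 2 * (m + 1))) =
          m * (m - 1) * a^2 * (3 * (a * D) - 2 * (m + 1) * a)"
        by (simp add: algebra_simps power2_eq_square power3_eq_cube)
      then show ?thesis by (simp only: aD mult_1_right)
    qed
    finally show ?thesis using a by simp
  qed
  then show "(m + 1 - 1) * (m + 1 - 2) * (3 * mass V p - 2 * (m + 1)) \<le> triangles V A p"
    by (simp add: algebra_simps)
qed

text \<open>For 1 and 2 parts the factor \<open>(m - 1) * (m - 2)\<close> vanishes, so the induction
  effectively starts at 2.\<close>

lemma razborov_bound: "1 \<le> k \<Longrightarrow> razborov_bound V (real k)"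
proof (induction k rule: nat_induct_at_least)
  case base
  show ?case by (auto simp: razborov_bound_def intro: weighted_graph.T_nonneg)
next
  case (Suc k)
  show ?case
  proof (cases "k = 1")
    case True
    then show ?thesis by (auto simp: razborov_bound_def intro: weighted_graph.T_nonneg)
  next
    case False
    then show ?thesis using razborov_bound_step[OF Suc.IH] Suc.hyps by (simp add: add.commute)
  qed
qed

subsection \<open>Razborov's function\<close>

text \<open>Edge and triangle density of the complete \<open>k\<close>-partite graph with one part of size \<open>z\<close> and
  \<open>k - 1\<close> equal parts.\<close>

definition part_edges :: "nat \<Rightarrow> real \<Rightarrow> real" where
  "part_edges k z = (1 - z) * (real k * z + real k - 2) / (real k - 1)"

definition part_triangles :: "nat \<Rightarrow> real \<Rightarrow> real" where
  "part_triangles k z =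
     (1 - z)^2 * (real k - 2) * (2 * z * real k + real k - 3) / (real k - 1)^2"

lemma part_edges_less:
  assumes "2 \<le> k" "x < y" "y \<le> 1 / real k"
  shows "part_edges k x < part_edges k y"
proof -
  have "real k * (x + y) < real k * (2 / real k)" using assms by (intro mult_strict_left_mono) auto
  then have "0 < (y - x) * (2 - real k * (x + y)) / (real k - 1)" using assms by simp
  also have "\<dots> = part_edges k y - part_edges k x"
    by (simp add: part_edges_def diff_divide_distrib[symmetric] algebra_simps)
  finally show ?thesis by simp
qed

lemma part_triangles_less:
  assumes k: "3 \<le> k" and xy: "0 \<le> x" "x < y" "y \<le> 1 / real k"
  shows "part_triangles k x < part_triangles k y"
proof -
  have "real k * (x + y) < real k * (2 / real k)" using assms by (intro mult_strict_left_mono) auto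
  then have ks: "real k * (x + y) < 2" using k by simp
  have "1 / real k \<le> 1" using k by simp
  then have s: "x + y < 2" using xy by linarith
  \<comment> \<open>Up to the positive factor \<open>(k - 2) / (k - 1)^2\<close> this is the
    increment of \<open>part_triangles\<close>, rewritten in terms of \<open>x + y\<close> and
    \<open>y - x\<close> so that every summand is visibly nonnegative.\<close>
  have "0 < (y - x) * (3/2 * ((2 - real k * (x + y)) * (2 - (x + y))) + real k / 2 * (y - x)^2)"
    using ks s xy by (intro mult_pos_pos add_pos_nonneg) auto
  then have "0 < (y - x) * (3/2 * ((2 - real k * (x + y)) * (2 - (x + y))) + real k / 2 * (y - x)^2)
      * (real k - 2) / (real k - 1)^2" using k by simp
  also have "\<dots> = part_triangles k y - part_triangles k x"
    unfolding part_triangles_def diff_divide_distrib[symmetric]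
    by (rule arg_cong2[of _ _ _ _ "(/)"]) (simp_all add: field_simps power2_eq_square)
  finally show ?thesis by simp
qed

lemma part_edges_ends:
  assumes "2 \<le> k"
  shows "part_edges k 0 = 1 - 1 / (real k - 1)" "part_edges k (1 / real k) = 1 - 1 / real k"
  using assms by (auto simp: part_edges_def field_simps)

lemma part_triangles_ends:
  assumes "2 \<le> k"
  shows "part_triangles k 0 = (1 - 1 / (real k - 1)) * (1 - 2 / (real k - 1))"
    and "part_triangles k (1 / real k) = (1 - 1 / real k) * (1 - 2 / real k)"
  using assms by (auto simp: part_triangles_def divide_simps power2_eq_square)

lemma part_edges_bounds:
  assumes "2 \<le> k" "0 < z" "z \<le> 1 / real k"
  shows "1 - 1 / (real k - 1) < part_edges k z" "part_edges k z \<le> 1 - 1 / real k"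
  using part_edges_less[of k 0 z] part_edges_less[of k z "1 / real k"] part_edges_ends[of k] assms
  by (auto simp: less_eq_real_def)

lemma part_triangles_bounds:
  assumes "3 \<le> k" "0 < z" "z \<le> 1 / real k"
  shows "part_triangles k 0 < part_triangles k z" "part_triangles k z \<le> part_triangles k (1 / real k)"
  using part_triangles_less[of k 0 z] part_triangles_less[of k z "1 / real k"] assms
  by (auto simp: less_eq_real_def)

text \<open>Discharges the \<open>LEAST\<close> and \<open>THE\<close> in the definition of
  \<open>g_R\<close>: minimality of \<open>k\<close> gives the lower end of its interval, the
  intermediate value theorem gives \<open>z\<close>, and strict monotonicity makes it
  unique.\<close>

lemma g_R_parametrisation:
  assumes d: "1/2 < d" "d < 1"
  obtains k z where "3 \<le> k" "0 < z" "z \<le> 1 / real k" "d = part_edges k z"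
    "g_R d = part_triangles k z"
proof -
  define k where "k = (LEAST k::nat. k \<ge> 1 \<and> d \<le> 1 - 1 / real k)"
  obtain n :: nat where n: "real n > 1 / (1 - d)" using reals_Archimedean2 by blast
  have n0: "real n > 0" using n d by (smt (verit) divide_pos_pos)
  then have "d \<le> 1 - 1 / real n" using n d by (simp add: field_simps)
  then have ex: "\<exists>k::nat. k \<ge> 1 \<and> d \<le> 1 - 1 / real k" using n0 by (intro exI[of _ n]) auto
  have k: "k \<ge> 1" "d \<le> 1 - 1 / real k" using LeastI_ex[OF ex] by (auto simp: k_def)
  have "k \<noteq> 1" "k \<noteq> 2" using k(2) d by auto
  then have k3: "k \<ge> 3" using k(1) by linarith
  have "\<not> (k - 1 \<ge> 1 \<and> d \<le> 1 - 1 / real (k - 1))"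
    using not_less_Least[of "k - 1" "\<lambda>k. k \<ge> 1 \<and> d \<le> 1 - 1 / real k"] k3 by (simp add: k_def)
  moreover have "k - 1 \<ge> 1" using k3 by linarith
  ultimately have low: "1 - 1 / (real k - 1) < d" using k3 by (simp add: of_nat_diff)
  have "\<exists>z. 0 \<le> z \<and> z \<le> 1 / real k \<and> part_edges k z = d"
  proof (rule IVT')
    show "continuous_on {0..1 / real k} (part_edges k)"
      unfolding part_edges_def using k3 by (intro continuous_intros) auto
  qed (use part_edges_ends[of k] k3 k low in auto)
  then obtain z where z: "0 \<le> z" "z \<le> 1 / real k" "d = part_edges k z" by auto
  have "z \<noteq> 0" using z(3) low part_edges_ends[of k] k3 by auto
  with z have z0: "0 < z" by simp
  have the_z: "(THE z. 0 < z \<and> z \<le> 1 / real k \<and>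
      d = (1 - z) * (real k * z + real k - 2) / (real k - 1)) = z"
  proof (rule the_equality)
    show "0 < z \<and> z \<le> 1 / real k \<and> d = (1 - z) * (real k * z + real k - 2) / (real k - 1)"
      using z z0 by (simp add: part_edges_def)
    fix z' assume z': "0 < z' \<and> z' \<le> 1 / real k \<and>
      d = (1 - z') * (real k * z' + real k - 2) / (real k - 1)"
    then have "part_edges k z' = part_edges k z"
      using z(3) unfolding part_edges_def by metis
    then show "z' = z"
      using part_edges_less[of k z z'] part_edges_less[of k z' z] z z' k3
      by (cases z z' rule: linorder_cases) auto
  qed
  have "g_R d = part_triangles k z"
    unfolding g_R_def Let_def k_def[symmetric] the_z part_triangles_def using d by simp
  with that k3 z0 z show thesis by blast
qed

text \<open>For different numbers of parts the edge densities fill the disjoint intervals from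
  \<open>1 - 1/(k-1)\<close> (excluded) to \<open>1 - 1/k\<close> (included), in increasing
  order.\<close>

lemma part_edges_inject_index:
  assumes "3 \<le> k" "3 \<le> l" "0 < z" "z \<le> 1 / real k" "0 < w" "w \<le> 1 / real l"
    and "part_edges k z \<le> part_edges l w"
  shows "k \<le> l"
proof (rule ccontr)
  assume "\<not> k \<le> l"
  then have "1 / (real k - 1) \<le> 1 / real l" using assms by (intro divide_left_mono) auto
  then show False
    using part_edges_bounds[of k z] part_edges_bounds[of l w] assms by linarith
qed

lemma g_R_part_edges:
  assumes "3 \<le> k" "0 < z" "z \<le> 1 / real k"
  shows "g_R (part_edges k z) = part_triangles k z" "1/2 < part_edges k z" "part_edges k z < 1"
proof -
  have "1 / (real k - 1) \<le> 1/2" using assms by (simp add: divide_simps)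
  then show b: "1/2 < part_edges k z"
    using part_edges_bounds[of k z] assms by linarith
  have "1 / real k > 0" using assms by simp
  then show c: "part_edges k z < 1" using part_edges_bounds[of k z] assms by linarith
  obtain l w where l: "3 \<le> l" "0 < w" "w \<le> 1 / real l" "part_edges k z = part_edges l w"
    "g_R (part_edges k z) = part_triangles l w"
    using g_R_parametrisation[OF b c] by metis
  have "k = l"
    using part_edges_inject_index[of k l z w] part_edges_inject_index[of l k w z] assms l by auto
  moreover have "z = w"
    using part_edges_less[of k z w] part_edges_less[of k w z] l assms \<open>k = l\<close>
    by (cases z w rule: linorder_cases) auto
  ultimately show "g_R (part_edges k z) = part_triangles k z" using l by simp
qed

lemma part_triangles_between:
  assumes "3 \<le> k" "0 < z" "z \<le> 1 / real k"
  shows "0 < part_triangles k z" "part_triangles k z < 1"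
proof -
  have "0 \<le> (1 - 1 / (real k - 1)) * (1 - 2 / (real k - 1))"
    using assms by (intro mult_nonneg_nonneg) (auto simp: divide_simps)
  then show "0 < part_triangles k z"
    using part_triangles_bounds[OF assms] part_triangles_ends(1)[of k] assms(1) by linarith
  have "(1 - 1 / real k) * (1 - 2 / real k) \<le> (1 - 1 / real k) * 1"
    using assms by (intro mult_left_mono) auto
  also have "\<dots> < 1" using assms by simp
  finally show "part_triangles k z < 1"
    using part_triangles_bounds[of k z] part_triangles_ends[of k] assms by auto
qed

lemma g_R_strict_mono:
  assumes "1/2 \<le> x" "x < y" "y \<le> 1"
  shows "g_R x < g_R y"
proof -
  have g1: "g_R 1 = 1" by (simp add: g_R_def)
  consider "x = 1/2" "y = 1" | "x = 1/2" "1/2 < y" "y < 1" | "1/2 < x" "y = 1" | "1/2 < x" "y < 1"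
    using assms by linarith
  then show ?thesis
  proof cases
    case 1
    then show ?thesis using g1 by (simp add: g_R_def)
  next
    case 2
    then have "g_R x = 0" by (simp add: g_R_def)
    then show ?thesis using g_R_parametrisation[OF 2(2,3)] part_triangles_between by metis
  next
    case 3
    then show ?thesis
      using g_R_parametrisation[of x] part_triangles_between assms g1 by metis
  next
    case 4
    have xy: "x < 1" "1/2 < y" using assms 4 by auto
    obtain k z where k: "3 \<le> k" "0 < z" "z \<le> 1 / real k" "x = part_edges k z"
      "g_R x = part_triangles k z"
      using g_R_parametrisation[OF 4(1) xy(1)] by metis
    obtain l w where l: "3 \<le> l" "0 < w" "w \<le> 1 / real l" "y = part_edges l w"
      "g_R y = part_triangles l w"
      using g_R_parametrisation[OF xy(2) 4(2)] by metis
    have "k \<le> l" using part_edges_inject_index[of k l z w] k l assms by auto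
    show ?thesis
    proof (cases "k = l")
      case True
      then have "z < w" using part_edges_less[of k w z] k l assms
        by (cases z w rule: linorder_cases) auto
      then show ?thesis using part_triangles_less[of k z w] k l True by auto
    next
      case False
      then have kl: "real k \<le> real l - 1" using \<open>k \<le> l\<close> by linarith
      have "part_triangles k z \<le> (1 - 1 / real k) * (1 - 2 / real k)"
        using part_triangles_bounds[of k z] part_triangles_ends[of k] k by auto
      also have "\<dots> \<le> (1 - 1 / (real l - 1)) * (1 - 2 / (real l - 1))"
        using kl k l by (intro mult_mono diff_mono divide_left_mono) auto
      also have "\<dots> < part_triangles l w"
        using part_triangles_bounds[of l w] part_triangles_ends[of l] l by auto
      finally show ?thesis using k l by simp
    qed
  qed
qed

lemma g_R_mono:
  assumes "1/2 \<le> x" "x \<le> y" "y \<le> 1"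
  shows "g_R x \<le> g_R y"
  using g_R_strict_mono[of x y] assms by (cases "x = y") auto

text \<open>The triangle densities of the balanced complete multipartite graphs cut (0,1) into
  intervals, and each is covered by letting the small part grow from 0 to full size.\<close>

lemma part_triangles_surj:
  assumes y: "0 < y" "y < 1"
  obtains k z where "3 \<le> k" "0 < z" "z \<le> 1 / real k" "y = part_triangles k z"
proof -
  define \<tau> where "\<tau> k = (1 - 1 / real k) * (1 - 2 / real k)" for k :: nat
  define k where "k = (LEAST k::nat. k \<ge> 2 \<and> y \<le> \<tau> k)"
  obtain n :: nat where n: "real n > 3 / (1 - y)" using reals_Archimedean2 by blast
  have "3 / (1 - y) \<ge> 3" using y by (simp add: field_simps)
  then have n3: "n \<ge> 2" using n by linarith
  \<comment> \<open>The choice of \<open>n\<close> rests on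
    \<open>(1 - 1/n) * (1 - 2/n) \<ge> 1 - 3/n\<close>.\<close>
  then have "y \<le> 1 - 3 / real n" using n y by (simp add: field_simps)
  also have "\<dots> \<le> \<tau> n" using n3 by (simp add: \<tau>_def field_simps)
  finally have ex: "\<exists>k::nat. k \<ge> 2 \<and> y \<le> \<tau> k" using n3 by blast
  have k: "k \<ge> 2" "y \<le> \<tau> k" using LeastI_ex[OF ex] by (auto simp: k_def)
  have "k \<noteq> 2" using k(2) y by (auto simp: \<tau>_def)
  then have k3: "k \<ge> 3" using k(1) by linarith
  have "\<not> (k - 1 \<ge> 2 \<and> y \<le> \<tau> (k - 1))"
    using not_less_Least[of "k - 1" "\<lambda>k. k \<ge> 2 \<and> y \<le> \<tau> k"] k3 by (simp add: k_def)
  moreover have "k - 1 \<ge> 2" using k3 by linarith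
  ultimately have low: "part_triangles k 0 < y"
    using k3 by (simp add: \<tau>_def of_nat_diff part_triangles_ends)
  have "\<exists>z. 0 \<le> z \<and> z \<le> 1 / real k \<and> part_triangles k z = y"
  proof (rule IVT')
    show "continuous_on {0..1 / real k} (part_triangles k)"
      unfolding part_triangles_def using k3 by (intro continuous_intros) auto
  qed (use part_triangles_ends[of k] k3 k low in \<open>auto simp: \<tau>_def\<close>)
  then obtain z where z: "0 \<le> z" "z \<le> 1 / real k" "y = part_triangles k z" by auto
  then have "z \<noteq> 0" using low by auto
  then show thesis using k3 z by (intro that[of k z]) auto
qed

lemma g_R_inv:
  assumes "0 \<le> y" "y \<le> 1"
  shows "1/2 \<le> g_R_inv y" "g_R_inv y \<le> 1" "g_R (g_R_inv y) = y"
proof -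
  have "\<exists>x. x \<in> {1/2..1} \<and> g_R x = y"
  proof -
    consider "y = 0" | "y = 1" | "0 < y" "y < 1" using assms by linarith
    then show ?thesis
    proof cases
      case 1
      then show ?thesis by (intro exI[of _ "1/2"]) (simp add: g_R_def)
    next
      case 2
      then show ?thesis by (intro exI[of _ 1]) (simp add: g_R_def)
    next
      case 3
      then show ?thesis
        using part_triangles_surj g_R_part_edges by (metis atLeastAtMost_iff less_imp_le)
    qed
  qed
  then obtain x where x: "x \<in> {1/2..1}" "g_R x = y" by blast
  have "g_R_inv y = x"
    unfolding g_R_inv_def
  proof (rule the_equality)
    fix x' assume "x' \<in> {1/2..1} \<and> g_R x' = y"
    then show "x' = x" using g_R_strict_mono[of x x'] g_R_strict_mono[of x' x] x
      by (cases x x' rule: linorder_cases) auto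
  qed (use x in auto)
  with x show "1/2 \<le> g_R_inv y" "g_R_inv y \<le> 1" "g_R (g_R_inv y) = y" by auto
qed

lemma g_R_inv_part_triangles:
  assumes "3 \<le> k" "0 < z" "z \<le> 1 / real k"
  shows "g_R_inv (part_triangles k z) = part_edges k z"
proof -
  let ?y = "part_triangles k z"
  have y: "0 \<le> ?y" "?y \<le> 1" using part_triangles_between[OF assms] by auto
  show ?thesis
    using g_R_strict_mono[of "g_R_inv ?y" "part_edges k z"]
      g_R_strict_mono[of "part_edges k z" "g_R_inv ?y"] g_R_inv[OF y] g_R_part_edges[OF assms]
    by (cases "g_R_inv ?y" "part_edges k z" rule: linorder_cases) auto
qed

lemma g_R_inv_0: "g_R_inv 0 = 1/2"
  using g_R_inv[of 0] g_R_strict_mono[of "1/2" "g_R_inv 0"]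
  by (cases "g_R_inv 0 = 1/2") (auto simp: g_R_def)

context weighted_graph
begin

theorem razborov:
  assumes D: "D = 1"
  shows "g_R E \<le> T"
proof -
  consider "E \<le> 1/2" | "E \<ge> 1" | "1/2 < E" "E < 1" by linarith
  then show ?thesis
  proof cases
    case 1
    then show ?thesis using T_nonneg by (simp add: g_R_def)
  next
    case 2
    then have "1 * 1 \<le> E * (2 * E - 1)" by (intro mult_mono) auto
    also have "\<dots> \<le> T" using goodman D by (simp add: power2_eq_square algebra_simps)
    finally show ?thesis using 2 by (simp add: g_R_def)
  next
    case 3
    obtain k z where k: "3 \<le> k" "0 < z" "z \<le> 1 / real k" "E = part_edges k z"
      "g_R E = part_triangles k z"
      using g_R_parametrisation[OF 3] by metis
    \<comment> \<open>The size of the \<open>k - 1\<close> equal parts; at this scale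
      \<open>E\<close> meets the edge hypothesis of \<open>razborov_bound\<close> for
      \<open>k\<close> parts with equality.\<close>
    define b where "b = (1 - z) / (real k - 1)"
    have z1: "real k * z \<le> 1" using k by (simp add: field_simps)
    have z: "z = 1 - (real k - 1) * b" using k by (simp add: b_def)
    have b: "real k * b \<ge> 1" using z1 k by (simp add: b_def field_simps)
    then have b0: "b > 0" using k by (smt (verit) mult_nonneg_nonpos of_nat_0_le_iff)
    have E_eq: "2 * (real k - 1) * b - real k * (real k - 1) * b^2 = E"
    proof -
      have "E = b * (real k * z + real k - 2)" by (simp add: k(4) part_edges_def b_def)
      then show ?thesis unfolding z by (simp add: algebra_simps power2_eq_square)
    qed
    have "(real k - 1) * (real k - 2) * b^2 * (3 * D - 2 * real k * b) \<le> T"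
      using b b0 E_eq k by (intro razborov_bound_scaled[OF razborov_bound]) (auto simp: D)
    moreover have "part_triangles k z = (real k - 1) * (real k - 2) * b^2 * (3 * D - 2 * real k * b)"
    proof -
      have "part_triangles k z = b^2 * (real k - 2) * (2 * z * real k + real k - 3)"
        by (simp add: part_triangles_def b_def power_divide)
      then show ?thesis unfolding z D by (simp add: algebra_simps power2_eq_square)
    qed
    ultimately show ?thesis using k by simp
  qed
qed

end

subsection \<open>Three-vertex densities of finite graphs\<close>

definition triples :: "graph \<Rightarrow> (nat \<Rightarrow> nat \<Rightarrow> nat \<Rightarrow> bool) \<Rightarrow> (nat \<times> nat \<times> nat) set" where
  "triples G P = {(x, y, z). x \<in> verts G \<and> y \<in> verts G \<and> z \<in> verts G \<and>
     x \<noteq> y \<and> x \<noteq> z \<and> y \<noteq> z \<and> P x y z}"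

definition copies :: "graph \<Rightarrow> nat \<Rightarrow> nat set set" where
  "copies G k = {U. U \<subseteq> verts G \<and> card U = 3 \<and> graph_iso (induced G U) (H3 k)}"

lemma H3_simps: "verts (H3 k) = {0, 1, 2}" "card (verts (H3 k)) = 3"
  by (auto simp: H3_def verts_def)

lemma adj_H3_3: "i \<in> {0,1,2} \<Longrightarrow> j \<in> {0,1,2} \<Longrightarrow> adj (H3 3) i j \<longleftrightarrow> i \<noteq> j"
  by (elim insertE emptyE) (simp_all add: H3_def adj_def doubleton_eq_iff)

lemma adj_H3_2: "i \<in> {0,1,2} \<Longrightarrow> j \<in> {0,1,2} \<Longrightarrow> adj (H3 2) i j \<longleftrightarrow> i \<noteq> j \<and> (i = 1 \<or> j = 1)"
  by (elim insertE emptyE) (simp_all add: H3_def adj_def doubleton_eq_iff)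

lemma induced_simps:
  "verts (induced G U) = U" "x \<in> U \<Longrightarrow> y \<in> U \<Longrightarrow> adj (induced G U) x y \<longleftrightarrow> adj G x y"
  by (auto simp: induced_def verts_def adj_def)

lemma ind_density_H3: "ind_density (H3 k) G = real (card (copies G k)) / real (card (verts G) choose 3)"
  by (simp only: ind_density_def copies_def H3_simps(2))

lemma finite_copies: "finite (verts G) \<Longrightarrow> finite (copies G k)"
  by (rule finite_subset[of _ "Pow (verts G)"]) (auto simp: copies_def)

lemma finite_triples: "finite (verts G) \<Longrightarrow> finite (triples G P)"
  by (rule finite_subset[of _ "verts G \<times> verts G \<times> verts G"]) (auto simp: triples_def)

lemma ind_density_bounds:
  assumes "finite (verts G)"
  shows "0 \<le> ind_density (H3 k) G" "ind_density (H3 k) G \<le> 1"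
proof -
  show "0 \<le> ind_density (H3 k) G" by (simp add: ind_density_H3)
  have "card (copies G k) \<le> card {U. U \<subseteq> verts G \<and> card U = 3}"
    using assms by (intro card_mono) (auto simp: copies_def)
  then have "card (copies G k) \<le> card (verts G) choose 3"
    using assms by (simp add: n_subsets)
  then have "real (card (copies G k)) \<le> real (card (verts G) choose 3)" by (rule of_nat_mono)
  moreover have "a / b \<le> 1" if "a \<le> b" "0 \<le> b" for a b :: real
    using that by (auto simp: divide_le_eq_1)
  ultimately show "ind_density (H3 k) G \<le> 1" unfolding ind_density_H3 by simp
qed

lemma graph_iso_H3_3:
  assumes G: "wf_graph G" and U: "card U = 3"
  shows "graph_iso (induced G U) (H3 3) \<longleftrightarrow> (\<forall>x\<in>U. \<forall>y\<in>U. x \<noteq> y \<longrightarrow> adj G x y)"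
proof
  assume "graph_iso (induced G U) (H3 3)"
  then obtain f where f: "bij_betw f U {0, 1, 2}"
    "\<forall>x\<in>U. \<forall>y\<in>U. adj G x y \<longleftrightarrow> adj (H3 3) (f x) (f y)"
    by (auto simp: graph_iso_def H3_simps induced_simps)
  show "\<forall>x\<in>U. \<forall>y\<in>U. x \<noteq> y \<longrightarrow> adj G x y"
  proof (intro ballI impI)
    fix x y assume xy: "x \<in> U" "y \<in> U" "x \<noteq> y"
    have "f x \<noteq> f y" "f x \<in> {0,1,2}" "f y \<in> {0,1,2}"
      using xy bij_betw_apply[OF f(1)] bij_betw_imp_inj_on[OF f(1)] by (blast dest: inj_onD)+
    then show "adj G x y" using f(2) xy adj_H3_3 by metis
  qed
next
  assume *: "\<forall>x\<in>U. \<forall>y\<in>U. x \<noteq> y \<longrightarrow> adj G x y"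
  have "finite U" using U by (simp add: card_ge_0_finite)
  then obtain f where f: "bij_betw f U {0::nat, 1, 2}"
    using finite_same_card_bij[of U "{0::nat, 1, 2}"] U by auto
  have "adj (induced G U) x y \<longleftrightarrow> adj (H3 3) (f x) (f y)" if "x \<in> U" "y \<in> U" for x y
  proof -
    have "f x \<in> {0,1,2}" "f y \<in> {0,1,2}" "f x = f y \<longleftrightarrow> x = y"
      using that bij_betw_apply[OF f] bij_betw_imp_inj_on[OF f] by (blast dest: inj_onD)+
    then show ?thesis
      using adj_H3_3 * that G by (metis induced_simps(2) wf_graph_def)
  qed
  then show "graph_iso (induced G U) (H3 3)"
    using f by (auto simp: graph_iso_def H3_simps induced_simps(1) intro!: exI[of _ f])
qed

lemma graph_iso_H3_2:
  assumes G: "wf_graph G"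
  shows "graph_iso (induced G U) (H3 2) \<longleftrightarrow>
    (\<exists>x y z. U = {x, y, z} \<and> x \<noteq> y \<and> x \<noteq> z \<and> y \<noteq> z \<and> adj G x y \<and> adj G x z \<and> \<not> adj G y z)"
proof
  assume "graph_iso (induced G U) (H3 2)"
  then obtain f where f: "bij_betw f U {0, 1, 2}"
    "\<forall>x\<in>U. \<forall>y\<in>U. adj G x y \<longleftrightarrow> adj (H3 2) (f x) (f y)"
    by (auto simp: graph_iso_def H3_simps induced_simps)
  define h where "h = the_inv_into U f"
  have h: "bij_betw h {0, 1, 2} U" unfolding h_def using f(1) by (rule bij_betw_the_inv_into)
  have fh: "f (h i) = i" if "i \<in> {0,1,2}" for i
    unfolding h_def using f(1) that by (intro f_the_inv_into_f_bij_betw)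
  have hU: "h 0 \<in> U" "h 1 \<in> U" "h 2 \<in> U" using h by (auto simp: bij_betw_def)
  have "U = {h 1, h 0, h 2}" using h by (auto simp: bij_betw_def)
  moreover have "h 1 \<noteq> h 0" "h 1 \<noteq> h 2" "h 0 \<noteq> h 2"
    using fh[of 0] fh[of 1] fh[of 2] by auto
  moreover have "adj G (h 1) (h 0)" "adj G (h 1) (h 2)" "\<not> adj G (h 0) (h 2)"
    using f(2) hU fh by (simp_all add: adj_H3_2)
  ultimately show "\<exists>x y z. U = {x, y, z} \<and> x \<noteq> y \<and> x \<noteq> z \<and> y \<noteq> z \<and>
      adj G x y \<and> adj G x z \<and> \<not> adj G y z" by blast
next
  assume "\<exists>x y z. U = {x, y, z} \<and> x \<noteq> y \<and> x \<noteq> z \<and> y \<noteq> z \<and> adj G x y \<and> adj G x z \<and> \<not> adj G y z"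
  then obtain x y z where U: "U = {x, y, z}" and d: "x \<noteq> y" "x \<noteq> z" "y \<noteq> z"
    and a: "adj G x y" "adj G x z" "\<not> adj G y z" by blast
  have s: "adj G y x" "adj G z x" "\<not> adj G z y" "\<not> adj G v v" for v
    using a G by (auto simp: wf_graph_def)
  define f :: "nat \<Rightarrow> nat" where "f v = (if v = x then 1 else if v = y then 0 else 2)" for v
  have f: "f x = 1" "f y = 0" "f z = 2" using d by (auto simp: f_def)
  have "bij_betw f U {0, 1, 2}" unfolding bij_betw_def inj_on_def U using f by auto
  moreover have "adj (induced G U) v w \<longleftrightarrow> adj (H3 2) (f v) (f w)" if "v \<in> U" "w \<in> U" for v w
  proof -
    have "f v \<in> {0,1,2}" "f w \<in> {0,1,2}" by (auto simp: f_def)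
    then have "adj (H3 2) (f v) (f w) \<longleftrightarrow> f v \<noteq> f w \<and> (f v = 1 \<or> f w = 1)" by (rule adj_H3_2)
    moreover have "adj (induced G U) v w \<longleftrightarrow> adj G v w" using that by (rule induced_simps)
    ultimately show ?thesis using that f a s unfolding U by auto
  qed
  ultimately show "graph_iso (induced G U) (H3 2)"
    by (auto simp: graph_iso_def H3_simps induced_simps(1) intro!: exI[of _ f])
qed

text \<open>Double counting along the map from an ordered triple to its vertex set.\<close>

lemma card_triples_fibres:
  assumes fin: "finite (verts G)"
    and img: "\<And>x y z. (x, y, z) \<in> triples G P \<Longrightarrow> {x, y, z} \<in> \<C>" and \<C>: "finite \<C>"
    and fibre: "\<And>U. U \<in> \<C> \<Longrightarrow> card {s \<in> triples G P. (\<lambda>(x, y, z). {x, y, z}) s = U} = n"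
  shows "card (triples G P) = n * card \<C>"
proof -
  have "(\<Sum>U\<in>\<C>. \<Sum>s\<in>{s \<in> triples G P. (\<lambda>(x, y, z). {x, y, z}) s = U}. 1::nat) =
      (\<Sum>s\<in>triples G P. 1)"
    using img by (intro sum.group finite_triples fin \<C>) auto
  then show ?thesis using fibre by (simp add: mult.commute)
qed

lemma triple_set_eq_iff:
  assumes "a \<noteq> b" "a \<noteq> c" "b \<noteq> c"
  shows "(\<lambda>(x, y, z). {x, y, z}) s = {a, b, c} \<longleftrightarrow>
    s \<in> {(a,b,c), (a,c,b), (b,a,c), (b,c,a), (c,a,b), (c,b,a)}"
proof (cases s)
  case (fields x y z)
  have "{x, y, z} = {a, b, c} \<longleftrightarrow> (x = a \<and> y = b \<and> z = c) \<or> (x = a \<and> y = c \<and> z = b) \<or>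
      (x = b \<and> y = a \<and> z = c) \<or> (x = b \<and> y = c \<and> z = a) \<or> (x = c \<and> y = a \<and> z = b) \<or>
      (x = c \<and> y = b \<and> z = a)" (is "?L \<longleftrightarrow> ?R")
  proof
    assume eq: ?L
    then have m: "y \<in> {a, b, c}" "z \<in> {a, b, c}" "a \<in> {x, y, z}" "b \<in> {x, y, z}" "c \<in> {x, y, z}"
      by blast+
    from eq have "x = a \<or> x = b \<or> x = c" by blast
    then show ?R
    proof (elim disjE)
      assume "x = a"
      then have "b = y \<or> b = z" "c = y \<or> c = z" using m(4,5) assms by simp_all
      then show ?R using \<open>x = a\<close> assms by blast
    next
      assume "x = b"
      then have "a = y \<or> a = z" "c = y \<or> c = z" using m(3,5) assms by simp_all
      then show ?R using \<open>x = b\<close> assms by blast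
    next
      assume "x = c"
      then have "a = y \<or> a = z" "b = y \<or> b = z" using m(3,4) assms by simp_all
      then show ?R using \<open>x = c\<close> assms by blast
    qed
  next
    assume ?R
    then show ?L by (elim disjE conjE) (simp_all add: insert_commute)
  qed
  then show ?thesis by (simp add: fields)
qed

lemma card_triangle_triples:
  assumes G: "wf_graph G"
  shows "card (triples G (\<lambda>x y z. adj G x y \<and> adj G x z \<and> adj G y z)) = 6 * card (copies G 3)"
proof (rule card_triples_fibres)
  let ?P = "\<lambda>x y z. adj G x y \<and> adj G x z \<and> adj G y z"
  show "finite (verts G)" using G by (simp add: wf_graph_def)
  then show "finite (copies G 3)" by (rule finite_copies)
  have sym: "adj G x y \<longleftrightarrow> adj G y x" for x y using G by (auto simp: wf_graph_def)
  show "{x, y, z} \<in> copies G 3" if "(x, y, z) \<in> triples G ?P" for x y z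
    using that G sym by (auto simp: triples_def copies_def graph_iso_H3_3)
  fix U assume U: "U \<in> copies G 3"
  then have "card U = 3" by (simp add: copies_def)
  then obtain a b c where abc: "U = {a, b, c}" "a \<noteq> b" "a \<noteq> c" "b \<noteq> c"
    by (auto simp: card_3_iff)
  have adj: "adj G a b" "adj G a c" "adj G b c" and V: "a \<in> verts G" "b \<in> verts G" "c \<in> verts G"
    using U G abc by (auto simp: copies_def graph_iso_H3_3)
  have adj': "adj G b a" "adj G c a" "adj G c b" using adj sym by blast+
  have "{(a,b,c), (a,c,b), (b,a,c), (b,c,a), (c,a,b), (c,b,a)} \<subseteq> triples G ?P"
    using adj adj' V abc(2-) by (simp add: triples_def)
  then have "{s \<in> triples G ?P. (\<lambda>(x, y, z). {x, y, z}) s = U} =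
      {(a,b,c), (a,c,b), (b,a,c), (b,c,a), (c,a,b), (c,b,a)}"
    unfolding abc(1) triple_set_eq_iff[OF abc(2-)] by blast
  then show "card {s \<in> triples G ?P. (\<lambda>(x, y, z). {x, y, z}) s = U} = 6"
    using abc(2-) by simp
qed

text \<open>The first entry must be the centre of the path, so only the two leaves can be
  exchanged.\<close>

lemma card_cherry_triples:
  assumes G: "wf_graph G"
  shows "card (triples G (\<lambda>x y z. adj G x y \<and> adj G x z \<and> \<not> adj G y z)) = 2 * card (copies G 2)"
proof (rule card_triples_fibres)
  let ?P = "\<lambda>x y z. adj G x y \<and> adj G x z \<and> \<not> adj G y z"
  show "finite (verts G)" using G by (simp add: wf_graph_def)
  then show "finite (copies G 2)" by (rule finite_copies)
  have sym: "adj G x y \<longleftrightarrow> adj G y x" for x y using G by (auto simp: wf_graph_def)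
  show "{x, y, z} \<in> copies G 2" if "(x, y, z) \<in> triples G ?P" for x y z
  proof -
    have "card {x, y, z} = 3" "{x, y, z} \<subseteq> verts G" using that by (auto simp: triples_def)
    then show ?thesis using that unfolding copies_def graph_iso_H3_2[OF G] triples_def by blast
  qed
  fix U assume U: "U \<in> copies G 2"
  then obtain a b c where abc: "U = {a, b, c}" "a \<noteq> b" "a \<noteq> c" "b \<noteq> c"
    and adj: "adj G a b" "adj G a c" "\<not> adj G b c"
    unfolding copies_def graph_iso_H3_2[OF G] by blast
  have V: "a \<in> verts G" "b \<in> verts G" "c \<in> verts G" using U abc by (auto simp: copies_def)
  have adj': "\<not> adj G c b" using adj sym by blast
  have "{(a,b,c), (a,c,b)} \<subseteq> triples G ?P"
    using adj adj' V abc(2-) by (simp add: triples_def)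
  moreover have "(b,a,c) \<notin> triples G ?P" "(b,c,a) \<notin> triples G ?P" "(c,a,b) \<notin> triples G ?P"
    "(c,b,a) \<notin> triples G ?P"
    using adj adj' by (simp_all add: triples_def)
  ultimately have "{s \<in> triples G ?P. (\<lambda>(x, y, z). {x, y, z}) s = U} = {(a,b,c), (a,c,b)}"
    unfolding abc(1) triple_set_eq_iff[OF abc(2-)] by blast
  then show "card {s \<in> triples G ?P. (\<lambda>(x, y, z). {x, y, z}) s = U} = 2"
    using abc(2-) by simp
qed

lemma choose_3: "real (n choose 3) = real n * (real n - 1) * (real n - 2) / 6"
  by (simp add: binomial_gbinomial gbinomial_prod_rev numeral_3_eq_3 fact_numeral lessThan_Suc atLeast0LessThan)

lemma ind_density_triples:
  assumes G: "wf_graph G"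
  defines "N \<equiv> real (card (verts G))"
  shows "ind_density (H3 3) G = real (card (triples G (\<lambda>x y z. adj G x y \<and> adj G x z \<and> adj G y z)))
      / (N * (N - 1) * (N - 2))"
    and "ind_density (H3 2) G = 3 * real (card (triples G (\<lambda>x y z. adj G x y \<and> adj G x z \<and> \<not> adj G y z)))
      / (N * (N - 1) * (N - 2))"
  unfolding card_triangle_triples[OF G] card_cherry_triples[OF G] ind_density_H3 choose_3 N_def
  by simp_all

lemma sum_of_bool_triples:
  assumes "finite V"
  shows "(\<Sum>x\<in>V. \<Sum>y\<in>V. \<Sum>z\<in>V. of_bool (P x y z) :: real) =
    real (card {(x, y, z). x \<in> V \<and> y \<in> V \<and> z \<in> V \<and> P x y z})"
proof -
  have "(\<Sum>x\<in>V. \<Sum>y\<in>V. \<Sum>z\<in>V. of_bool (P x y z) :: real) =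
      (\<Sum>s\<in>V \<times> V \<times> V. of_bool (case s of (x, y, z) \<Rightarrow> P x y z))"
    by (simp add: sum.cartesian_product case_prod_beta)
  also have "\<dots> = real (card ((V \<times> V \<times> V) \<inter> {s. case s of (x, y, z) \<Rightarrow> P x y z}))"
    using assms by (subst sum_of_bool_eq) auto
  also have "(V \<times> V \<times> V) \<inter> {s. case s of (x, y, z) \<Rightarrow> P x y z} =
      {(x, y, z). x \<in> V \<and> y \<in> V \<and> z \<in> V \<and> P x y z}" by auto
  finally show ?thesis .
qed

text \<open>With uniform weights \<open>1 / N\<close>, sums over all vertex triples also admit
  repetitions. The factor \<open>\<rho>\<close> converts densities of distinct triples into these
  sums, and \<open>e\<close> is the edge weight of the resulting weighted graph.\<close>

lemma graph_density_bound:
  assumes G: "wf_graph G" and N3: "3 \<le> card (verts G)"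
  defines "N \<equiv> real (card (verts G))"
  defines "\<rho> \<equiv> (N - 1) * (N - 2) / N^2"
  obtains e where "e \<le> 1" "g_R e \<le> \<rho> * ind_density (H3 3) G"
    "\<rho> * ind_density (H3 2) G \<le> 3/2 * (e - \<rho> * ind_density (H3 3) G)"
proof -
  define V where "V = verts G"
  define A where "A x y = (of_bool (adj G x y) :: real)" for x y
  define p where "p x = 1 / N" for x :: nat
  have fin: "finite V" using G by (simp add: wf_graph_def V_def)
  have N: "N \<ge> 3" "N > 0" using N3 by (auto simp: N_def)
  interpret weighted_graph V A p
    by unfold_locales (use fin G N in \<open>auto simp: sym_kernel_def A_def p_def wf_graph_def\<close>)
  have irrefl: "\<not> adj G x x" and sym: "adj G x y \<Longrightarrow> adj G y x" for x y
    using G by (auto simp: wf_graph_def)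
  have D: "D = 1" using N by (simp add: mass_def p_def N_def V_def)
  have T: "T = \<rho> * ind_density (H3 3) G"
  proof -
    have "T = (\<Sum>x\<in>V. \<Sum>y\<in>V. \<Sum>z\<in>V. of_bool (adj G x y \<and> adj G x z \<and> adj G y z)) / N^3"
      by (simp add: triangles_eq A_def p_def sum_divide_distrib power3_eq_cube of_bool_conj mult_ac)
    also have "\<dots> = real (card (triples G (\<lambda>x y z. adj G x y \<and> adj G x z \<and> adj G y z))) / N^3"
      unfolding sum_of_bool_triples[OF fin] using irrefl
      by (auto intro!: arg_cong[of _ _ card] arg_cong[of _ _ real] arg_cong2[of _ _ _ _ "(/)"]
          simp: triples_def V_def)
    also have "\<dots> = \<rho> * ind_density (H3 3) G"
      using N unfolding ind_density_triples(1)[OF G] \<rho>_def N_def[symmetric]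
      by (simp add: divide_simps power2_eq_square power3_eq_cube)
    finally show ?thesis .
  qed
  have cherries: "\<rho> * ind_density (H3 2) G \<le> 3 * ((\<Sum>x\<in>V. p x * (d x)^2) - T)"
  proof -
    \<comment> \<open>Only an inequality, since triples with \<open>y = z\<close> count on the
      right: a vertex is not adjacent to itself.\<close>
    have "real (card (triples G (\<lambda>x y z. adj G x y \<and> adj G x z \<and> \<not> adj G y z))) \<le>
        real (card {(x, y, z). x \<in> V \<and> y \<in> V \<and> z \<in> V \<and> adj G x y \<and> adj G x z \<and> \<not> adj G y z})"
      using fin by (intro of_nat_mono card_mono finite_subset[OF _ finite_cartesian_product[OF fin
        finite_cartesian_product[OF fin fin]]]) (auto simp: triples_def V_def)
    also have "\<dots> = (\<Sum>x\<in>V. \<Sum>y\<in>V. \<Sum>z\<in>V. A x y * A x z - A x y * A x z * A y z)"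
      unfolding sum_of_bool_triples[OF fin, symmetric] by (intro sum.cong) (auto simp: A_def)
    also have "\<dots> / N^3 = (\<Sum>x\<in>V. p x * (d x)^2) - T"
      by (simp add: triangles_eq p_def mass_def link_def sum_subtractf sum_divide_distrib
          diff_divide_distrib power2_eq_square power3_eq_cube sum_product mult_ac)
    finally have le: "real (card (triples G (\<lambda>x y z. adj G x y \<and> adj G x z \<and> \<not> adj G y z))) / N^3 \<le>
        (\<Sum>x\<in>V. p x * (d x)^2) - T" using N by (simp add: divide_right_mono)
    have eq: "\<rho> * ind_density (H3 2) G =
        3 * (real (card (triples G (\<lambda>x y z. adj G x y \<and> adj G x z \<and> \<not> adj G y z))) / N^3)"
      using N unfolding ind_density_triples(2)[OF G] \<rho>_def N_def[symmetric]
      by (simp add: divide_simps power2_eq_square power3_eq_cube)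
    show ?thesis unfolding eq using le by (intro mult_left_mono) auto
  qed
  have "d x \<le> 1" for x
  proof -
    have "d x \<le> D" unfolding mass_def link_def
      using weight_nonneg A_le_1 by (intro sum_mono) (simp add: mult_left_le)
    then show ?thesis using D by simp
  qed
  then have "E \<le> D" unfolding edges_def mass_def[of V p]
    using weight_nonneg by (intro sum_mono) (simp add: mult_left_le)
  then have "E \<le> 1" using D by simp
  moreover have "g_R E \<le> \<rho> * ind_density (H3 3) G" using razborov[OF D] T by simp
  moreover have "\<rho> * ind_density (H3 2) G \<le> 3/2 * (E - \<rho> * ind_density (H3 3) G)"
    using cherries goodman_sq D T by simp
  ultimately show thesis by (rule that)
qed

lemma S23_upper:
  assumes "(d2, d3) \<in> S23"
  shows "0 \<le> d2" "0 \<le> d3" "d3 \<le> 1" "d2 \<le> 3/2 * (g_R_inv d3 - d3)"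
proof -
  have approx: "\<exists>G. wf_graph G \<and> n \<le> card (verts G) \<and> \<bar>ind_density (H3 2) G - d2\<bar> \<le> \<epsilon> \<and>
      \<bar>ind_density (H3 3) G - d3\<bar> \<le> \<epsilon>" if "\<epsilon> > 0" for \<epsilon> n
    using assms that unfolding S23_def S_set_def by fastforce
  have bounds: "0 \<le> ind_density (H3 k) G" "ind_density (H3 k) G \<le> 1" if "wf_graph G" for k G
    using that ind_density_bounds by (auto simp: wf_graph_def)
  have "0 \<le> d2 + \<epsilon> \<and> 0 \<le> d3 + \<epsilon> \<and> d3 \<le> 1 + \<epsilon>" if "\<epsilon> > 0" for \<epsilon>
    using approx[OF that, of 0] bounds by (smt (verit))
  then show d2: "0 \<le> d2" and d3: "0 \<le> d3" "d3 \<le> 1"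
    by (meson field_le_epsilon)+
  define x where "x = g_R_inv d3"
  have x: "1/2 \<le> x" "x \<le> 1" "g_R x = d3" using g_R_inv d3 by (auto simp: x_def)
  show "d2 \<le> 3/2 * (g_R_inv d3 - d3)"
  proof (rule ccontr)
    assume "\<not> d2 \<le> 3/2 * (g_R_inv d3 - d3)"
    then have \<delta>: "2/3 * d2 + d3 - x > 0" by (simp add: x_def field_simps)
    define \<delta> where "\<delta> = 2/3 * d2 + d3 - x"
    have \<delta>0: "\<delta> > 0" using \<delta> by (simp add: \<delta>_def)
    \<comment> \<open>A violation by \<open>\<delta>\<close> forces edge densities of at least
      \<open>e'\<close>, strictly to the right of \<open>x\<close>, where \<open>g_R\<close> already
      exceeds \<open>d3\<close>; if \<open>e'\<close> is above 1 no such density exists.\<close>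
    define e' where "e' = x + \<delta> / 2"
    \<comment> \<open>Approximating the two densities and bounding \<open>\<rho>\<close> below by
      \<open>1 - \<epsilon>\<close> cost at most \<open>2 * \<epsilon>\<close> each, which
      \<open>\<delta> / 8\<close> keeps within \<open>\<delta> / 2\<close>.\<close>
    define \<epsilon> where "\<epsilon> = (if e' \<le> 1 then min (\<delta> / 8) ((g_R e' - d3) / 2) else \<delta> / 8)"
    have g: "d3 < g_R e'" if "e' \<le> 1"
      using g_R_strict_mono[of x e'] x that \<delta>0 by (simp add: e'_def)
    have \<epsilon>: "\<epsilon> > 0" "\<epsilon> \<le> \<delta> / 8" "e' \<le> 1 \<Longrightarrow> d3 + \<epsilon> < g_R e'"
      using g \<delta>0 by (auto simp: \<epsilon>_def min_def field_simps)
    obtain n :: nat where n: "real n > 3 / \<epsilon>" using reals_Archimedean2 by blast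
    obtain G where G: "wf_graph G" "max n 3 \<le> card (verts G)"
      "\<bar>ind_density (H3 2) G - d2\<bar> \<le> \<epsilon>" "\<bar>ind_density (H3 3) G - d3\<bar> \<le> \<epsilon>"
      using approx[OF \<epsilon>(1), of "max n 3"] by blast
    define N where "N = real (card (verts G))"
    define \<rho> where "\<rho> = (N - 1) * (N - 2) / N^2"
    have N: "N \<ge> 3" "N > 3 / \<epsilon>" using G(2) n by (auto simp: N_def)
    have \<rho>_eq: "\<rho> = 1 - 3 / N + 2 / N^2" using N by (simp add: \<rho>_def field_simps power2_eq_square)
    have "2 / N^2 \<ge> 0" by simp
    moreover have "3 / N \<le> \<epsilon>" using N \<epsilon>(1) by (simp add: field_simps)
    ultimately have \<rho>: "1 - \<epsilon> \<le> \<rho>" using \<rho>_eq by linarith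
    have "(N - 1) * (N - 2) \<le> N * N" using N by (intro mult_mono) auto
    then have \<rho>1: "\<rho> \<le> 1" using N by (simp add: \<rho>_def power2_eq_square)
    obtain e where e: "e \<le> 1" "g_R e \<le> \<rho> * ind_density (H3 3) G"
      "\<rho> * ind_density (H3 2) G \<le> 3/2 * (e - \<rho> * ind_density (H3 3) G)"
      using graph_density_bound[OF G(1)] G(2) unfolding \<rho>_def N_def by auto
    define Y where "Y = 2/3 * ind_density (H3 2) G + ind_density (H3 3) G"
    have Y: "0 \<le> Y" "Y \<le> 2" using bounds[OF G(1), of 2] bounds[OF G(1), of 3] by (auto simp: Y_def)
    have "\<rho> * Y \<le> e" using e(3) by (simp add: Y_def algebra_simps)
    moreover have "Y - 2 * \<epsilon> \<le> \<rho> * Y"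
    proof -
      have "(1 - \<rho>) * Y \<le> \<epsilon> * 2" using Y \<rho> \<rho>1 by (intro mult_mono) auto
      then show ?thesis by (simp add: algebra_simps)
    qed
    moreover have "x + \<delta> - 2 * \<epsilon> \<le> Y" using G(3,4) by (simp add: \<delta>_def Y_def abs_le_iff)
    ultimately have e': "e' \<le> e" using \<epsilon>(2) by (simp add: e'_def)
    then have "g_R e' \<le> g_R e" using x \<delta>0 e(1) by (intro g_R_mono) (auto simp: e'_def)
    also have "\<dots> \<le> \<rho> * ind_density (H3 3) G" by (rule e(2))
    also have "\<dots> \<le> 1 * ind_density (H3 3) G"
      using \<rho>1 bounds[OF G(1)] by (intro mult_right_mono) auto
    also have "\<dots> \<le> d3 + \<epsilon>" using G(4) by (simp add: abs_le_iff)
    finally show False using \<epsilon>(3) e' e(1) by linarith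
  qed
qed

subsection \<open>Constructions\<close>

text \<open>Membership also asks for limits of the two remaining densities; compactness of the unit
  square provides them along a subsequence.\<close>

lemma S23I:
  assumes G: "\<And>M. wf_graph (G M)" and card: "\<And>M. M \<le> card (verts (G M))"
    and a: "(\<lambda>M. ind_density (H3 2) (G M)) \<longlonglongrightarrow> a"
    and b: "(\<lambda>M. ind_density (H3 3) (G M)) \<longlonglongrightarrow> b"
  shows "(a, b) \<in> S23"
proof -
  define D where "D k M = ind_density (H3 k) (G M)" for k M
  have fin: "finite (verts (G M))" for M using G by (simp add: wf_graph_def)
  have "seq_compact ({0..1 :: real} \<times> {0..1 :: real})"
    by (intro compact_imp_seq_compact compact_Times compact_Icc)
  moreover have "\<forall>M. (D 0 M, D 1 M) \<in> {0..1} \<times> {0..1}"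
    using ind_density_bounds[OF fin] by (simp add: D_def)
  ultimately obtain l r where r: "strict_mono r" and lim: "((\<lambda>M. (D 0 M, D 1 M)) \<circ> r) \<longlonglongrightarrow> l"
    by (rule seq_compactE)
  have lim0: "(\<lambda>M. D 0 (r M)) \<longlonglongrightarrow> fst l" and lim1: "(\<lambda>M. D 1 (r M)) \<longlonglongrightarrow> snd l"
    using tendsto_fst[OF lim] tendsto_snd[OF lim] by (simp_all add: o_def)
  have lim2: "(\<lambda>M. D 2 (r M)) \<longlonglongrightarrow> a" and lim3: "(\<lambda>M. D 3 (r M)) \<longlonglongrightarrow> b"
    using LIMSEQ_subseq_LIMSEQ[OF a r] LIMSEQ_subseq_LIMSEQ[OF b r] by (simp_all add: o_def D_def)
  have "(fst l, snd l, a, b) \<in> S_set"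
    unfolding S_set_def
  proof (clarsimp, goal_cases)
    case (1 \<epsilon> n)
    have near: "eventually (\<lambda>M. \<bar>f M - c\<bar> \<le> \<epsilon>) sequentially" if "f \<longlonglongrightarrow> c" for f c
      using tendstoD[OF that 1] by eventually_elim (simp add: dist_real_def)
    have "eventually (\<lambda>M. n \<le> M \<and> \<bar>D 0 (r M) - fst l\<bar> \<le> \<epsilon> \<and> \<bar>D 1 (r M) - snd l\<bar> \<le> \<epsilon> \<and>
        \<bar>D 2 (r M) - a\<bar> \<le> \<epsilon> \<and> \<bar>D 3 (r M) - b\<bar> \<le> \<epsilon>) sequentially"
      by (intro eventually_conj eventually_ge_at_top near lim0 lim1 lim2 lim3)
    then obtain M where M: "n \<le> M" "\<bar>D 0 (r M) - fst l\<bar> \<le> \<epsilon>" "\<bar>D 1 (r M) - snd l\<bar> \<le> \<epsilon>"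
        "\<bar>D 2 (r M) - a\<bar> \<le> \<epsilon>" "\<bar>D 3 (r M) - b\<bar> \<le> \<epsilon>"
      by (auto dest: eventually_happens)
    have "n \<le> card (verts (G (r M)))" using M(1) seq_suble[OF r, of M] card[of "r M"] by linarith
    then show ?case using M G
      by (intro exI[of _ "fst (G (r M))"] exI[of _ "snd (G (r M))"]) (simp add: D_def)
  qed
  then show ?thesis by (auto simp: S23_def)
qed

text \<open>Vertices have to be natural numbers, so a blow-up vertex is the code of a pair of block
  number and index within the block.\<close>

definition block :: "nat \<Rightarrow> nat" where "block v = fst (prod_decode v)"

text \<open>Blow-up of a pattern \<open>R\<close> on \<open>K\<close> blocks: two distinct vertices are joined if \<open>R\<close> holds for
  their blocks, so block \<open>i\<close> is a clique if \<open>R i i\<close> and independent otherwise.\<close>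
definition blow_up :: "nat \<Rightarrow> (nat \<Rightarrow> nat) \<Rightarrow> (nat \<Rightarrow> nat \<Rightarrow> bool) \<Rightarrow> graph" where
  "blow_up K n R = (prod_encode ` (SIGMA j:{..<K}. {..<n j}),
     \<lambda>x y. x \<noteq> y \<and> R (block x) (block y))"

lemma sum_blow_up:
  "(\<Sum>v\<in>verts (blow_up K n R). f (block v)) = (\<Sum>j<K. real (n j) * f j)"
proof -
  have "(\<Sum>v\<in>verts (blow_up K n R). f (block v)) = (\<Sum>x\<in>(SIGMA j:{..<K}. {..<n j}). f (fst x))"
    unfolding blow_up_def verts_def fst_conv
    by (subst sum.reindex) (auto simp: block_def intro: inj_prod_encode inj_on_subset)
  also have "\<dots> = (\<Sum>j<K. \<Sum>i<n j. f j)"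
    by (subst sum.Sigma) (auto simp: case_prod_beta)
  finally show ?thesis by simp
qed

lemma finite_verts_blow_up: "finite (verts (blow_up K n R))"
  by (simp add: blow_up_def verts_def)

lemma card_verts_blow_up: "real (card (verts (blow_up K n R))) = (\<Sum>j<K. real (n j))"
  using sum_blow_up[of "\<lambda>_. 1" K n R] by simp

lemma wf_graph_blow_up:
  assumes "\<And>i j. R i j \<Longrightarrow> R j i"
  shows "wf_graph (blow_up K n R)"
  using assms finite_verts_blow_up by (auto simp: wf_graph_def blow_up_def adj_def)

lemma card_triples_blow_up:
  fixes F :: "nat \<Rightarrow> nat \<Rightarrow> nat \<Rightarrow> bool" and K :: nat and n :: "nat \<Rightarrow> nat"
    and R :: "nat \<Rightarrow> nat \<Rightarrow> bool"
  defines "G \<equiv> blow_up K n R"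
  shows "\<bar>real (card (triples G (\<lambda>x y z. F (block x) (block y) (block z)))) -
      (\<Sum>i<K. \<Sum>j<K. \<Sum>l<K. real (n i) * real (n j) * real (n l) * of_bool (F i j l))\<bar>
    \<le> 3 * real (card (verts G))^2"
proof -
  define V where "V = verts G"
  have fin: "finite V" by (simp add: V_def G_def finite_verts_blow_up)
  let ?P = "\<lambda>x y z. F (block x) (block y) (block z)"
  let ?all = "{(x, y, z). x \<in> V \<and> y \<in> V \<and> z \<in> V \<and> ?P x y z}"
  \<comment> \<open>The triples with a repeated vertex, covered by three copies of
    \<open>V \<times> V\<close>; they account for the quadratic error.\<close>
  let ?deg = "(\<lambda>(x, z). (x, x, z)) ` (V \<times> V) \<union> (\<lambda>(x, y). (x, y, x)) ` (V \<times> V) \<union>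
    (\<lambda>(x, y). (x, y, y)) ` (V \<times> V)"
  have fin_all: "finite ?all"
    by (rule finite_subset[of _ "V \<times> V \<times> V"]) (use fin in auto)
  have fin_deg: "finite ?deg" using fin by simp
  have "real (card ?all) = (\<Sum>x\<in>V. \<Sum>y\<in>V. \<Sum>z\<in>V. of_bool (?P x y z))"
    using sum_of_bool_triples[OF fin] by simp
  also have "\<dots> = (\<Sum>x\<in>V. \<Sum>y\<in>V. \<Sum>l<K. real (n l) * of_bool (F (block x) (block y) l))"
    unfolding V_def G_def
    by (intro sum.cong refl sum_blow_up[where f = "\<lambda>l. of_bool (F (block x) (block y) l)" for x y])
  also have "\<dots> = (\<Sum>x\<in>V. \<Sum>j<K. real (n j) * (\<Sum>l<K. real (n l) * of_bool (F (block x) j l)))"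
    unfolding V_def G_def
    by (intro sum.cong refl sum_blow_up[where
          f = "\<lambda>j. \<Sum>l<K. real (n l) * of_bool (F (block x) j l)" for x])
  also have "\<dots> = (\<Sum>i<K. real (n i) * (\<Sum>j<K. real (n j) * (\<Sum>l<K. real (n l) * of_bool (F i j l))))"
    unfolding V_def G_def
    by (rule sum_blow_up[where
          f = "\<lambda>i. \<Sum>j<K. real (n j) * (\<Sum>l<K. real (n l) * of_bool (F i j l))"])
  also have "\<dots> = (\<Sum>i<K. \<Sum>j<K. \<Sum>l<K. real (n i) * real (n j) * real (n l) * of_bool (F i j l))"
    by (simp only: sum_distrib_left mult.assoc)
  finally have all: "real (card ?all) = \<dots>" .
  have "card (triples G ?P) \<le> card ?all"
    using fin_all by (intro card_mono) (auto simp: triples_def V_def)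
  moreover have "card ?all \<le> card (triples G ?P) + 3 * card V^2"
  proof -
    have "card ?all \<le> card (triples G ?P \<union> ?deg)"
    proof (rule card_mono)
      show "finite (triples G ?P \<union> ?deg)"
        using finite_triples[of G ?P] fin fin_deg by (simp add: V_def)
      show "?all \<subseteq> triples G ?P \<union> ?deg"
      proof
        fix s assume "s \<in> ?all"
        then obtain x y z where s: "s = (x, y, z)" "x \<in> V" "y \<in> V" "z \<in> V" "?P x y z" by auto
        then have "s \<in> triples G ?P \<or> x = y \<or> x = z \<or> y = z" by (auto simp: triples_def V_def)
        then show "s \<in> triples G ?P \<union> ?deg" using s by (elim disjE) force+
      qed
    qed
    also have "\<dots> \<le> card (triples G ?P) + card ?deg" by (rule card_Un_le)
    also have "card ?deg \<le> card (V \<times> V) + card (V \<times> V) + card (V \<times> V)"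
      using fin by (intro order_trans[OF card_Un_le] add_mono card_image_le) auto
    finally show ?thesis using fin by (simp add: card_cartesian_product power2_eq_square)
  qed
  ultimately have "real (card (triples G ?P)) \<le> real (card ?all)"
    "real (card ?all) \<le> real (card (triples G ?P) + 3 * card V^2)"
    by (auto intro: of_nat_mono simp del: of_nat_add)
  moreover have "real (card (triples G ?P) + 3 * card V^2) =
      real (card (triples G ?P)) + 3 * real (card V)^2" by simp
  ultimately show ?thesis unfolding all[symmetric] V_def[symmetric] by linarith
qed

lemma nat_ceiling_tendsto:
  fixes w :: real
  assumes "0 \<le> w"
  shows "(\<lambda>M. real (nat \<lceil>w * real M\<rceil>) / real M) \<longlonglongrightarrow> w"
proof (rule tendsto_sandwich)
  have n: "real (nat \<lceil>w * real M\<rceil>) = of_int \<lceil>w * real M\<rceil>" for M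
    using assms by (simp add: of_nat_nat)
  show "\<forall>\<^sub>F M in sequentially. w \<le> real (nat \<lceil>w * real M\<rceil>) / real M"
    using eventually_gt_at_top[of 0]
    by eventually_elim (simp add: n field_simps)
  show "\<forall>\<^sub>F M in sequentially. real (nat \<lceil>w * real M\<rceil>) / real M \<le> w + 1 / real M"
    using eventually_gt_at_top[of 0]
  proof eventually_elim
    case (elim M)
    have "of_int \<lceil>w * real M\<rceil> \<le> w * real M + 1" by linarith
    then show ?case using elim by (simp add: n field_simps)
  qed
  have "(\<lambda>M. w + 1 / real M) \<longlonglongrightarrow> w + 0" by (intro tendsto_intros lim_1_over_n)
  then show "(\<lambda>M. w + 1 / real M) \<longlonglongrightarrow> w" by simp
qed simp

text \<open>Blocks of size \<open>w j * M\<close> rounded up give total size at least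
  \<open>M\<close> and asymptotic to \<open>M\<close>. Repeated vertices contribute
  \<open>O(M^2)\<close> triples, so normalised counts tend to the sums over the pattern.\<close>

lemma step_graph_in_S23:
  fixes w :: "nat \<Rightarrow> real"
  assumes w: "\<And>j. j < K \<Longrightarrow> 0 \<le> w j" "(\<Sum>j<K. w j) = 1" and R: "\<And>i j. R i j \<Longrightarrow> R j i"
  shows "(3 * (\<Sum>i<K. \<Sum>j<K. \<Sum>l<K. w i * w j * w l * of_bool (R i j \<and> R i l \<and> \<not> R j l)),
    \<Sum>i<K. \<Sum>j<K. \<Sum>l<K. w i * w j * w l * of_bool (R i j \<and> R i l \<and> R j l)) \<in> S23"
proof -
  define n where "n M j = nat \<lceil>w j * real M\<rceil>" for M j
  define G where "G M = blow_up K (n M) R" for M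
  define N where "N M = real (card (verts (G M)))" for M
  have G: "wf_graph (G M)" for M unfolding G_def using R by (rule wf_graph_blow_up)
  have nlim: "(\<lambda>M. real (n M j) / real M) \<longlonglongrightarrow> w j" if "j < K" for j
    unfolding n_def using w(1)[OF that] by (rule nat_ceiling_tendsto)
  have N_eq: "N M = (\<Sum>j<K. real (n M j))" for M
    by (simp add: N_def G_def card_verts_blow_up)
  have N_ge: "real M \<le> N M" for M
  proof -
    have "real M = (\<Sum>j<K. w j * real M)" using w(2) by (simp add: sum_distrib_right[symmetric])
    also have "\<dots> \<le> N M" unfolding N_eq n_def by (intro sum_mono) linarith
    finally show ?thesis .
  qed
  have Nlim: "(\<lambda>M. N M / real M) \<longlonglongrightarrow> 1"
  proof -
    have "(\<lambda>M. \<Sum>j<K. real (n M j) / real M) \<longlonglongrightarrow> (\<Sum>j<K. w j)"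
      using nlim by (intro tendsto_sum) auto
    then show ?thesis by (simp add: N_eq sum_divide_distrib w(2))
  qed
  have one_over: "(\<lambda>M. c / real M) \<longlonglongrightarrow> 0" for c :: real by (rule lim_const_over_n)
  have lim: "(\<lambda>M. real (card (triples (G M) (\<lambda>x y z. F (block x) (block y) (block z)))) /
      (N M * (N M - 1) * (N M - 2))) \<longlonglongrightarrow>
      (\<Sum>i<K. \<Sum>j<K. \<Sum>l<K. w i * w j * w l * of_bool (F i j l))" for F
  proof -
    define c where "c M = real (card (triples (G M) (\<lambda>x y z. F (block x) (block y) (block z))))" for M
    define s where "s M = (\<Sum>i<K. \<Sum>j<K. \<Sum>l<K. (real (n M i) / real M) * (real (n M j) / real M) *
      (real (n M l) / real M) * of_bool (F i j l))" for M
    let ?L = "\<Sum>i<K. \<Sum>j<K. \<Sum>l<K. w i * w j * w l * of_bool (F i j l)"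
    have slim: "s \<longlonglongrightarrow> ?L"
      unfolding s_def[abs_def] by (intro tendsto_intros nlim) auto
    have "(\<lambda>M. c M / real M ^ 3 - s M) \<longlonglongrightarrow> 0"
    proof (rule Lim_null_comparison)
      show "\<forall>\<^sub>F M in sequentially. norm (c M / real M ^ 3 - s M) \<le> 3 * (N M / real M)^2 * (1 / real M)"
        using eventually_gt_at_top[of 0]
      proof eventually_elim
        case (elim M)
        let ?S = "\<Sum>i<K. \<Sum>j<K. \<Sum>l<K. real (n M i) * real (n M j) * real (n M l) * of_bool (F i j l)"
        have "s M = ?S / real M ^ 3"
          unfolding s_def sum_divide_distrib
          by (intro sum.cong refl) (simp add: power3_eq_cube)
        then have "c M / real M ^ 3 - s M = (c M - ?S) / real M ^ 3"
          by (simp add: diff_divide_distrib)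
        moreover have "\<bar>c M - ?S\<bar> \<le> 3 * N M ^ 2"
          unfolding c_def N_def G_def by (rule card_triples_blow_up)
        ultimately have "norm (c M / real M ^ 3 - s M) \<le> 3 * N M ^ 2 / real M ^ 3"
          by (simp add: divide_right_mono)
        also have "\<dots> = 3 * (N M / real M)^2 * (1 / real M)"
          by (simp add: power2_eq_square power3_eq_cube)
        finally show ?case .
      qed
      have "(\<lambda>M. 3 * (N M / real M)^2 * (1 / real M)) \<longlonglongrightarrow> 3 * 1^2 * 0"
        by (intro tendsto_intros Nlim one_over)
      then show "(\<lambda>M. 3 * (N M / real M)^2 * (1 / real M)) \<longlonglongrightarrow> 0" by simp
    qed
    then have "(\<lambda>M. (c M / real M ^ 3 - s M) + s M) \<longlonglongrightarrow> 0 + ?L"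
      using slim by (rule tendsto_add)
    then have clim: "(\<lambda>M. c M / real M ^ 3) \<longlonglongrightarrow> ?L" by simp
    have "(\<lambda>M. (N M / real M) * (N M / real M - 1 / real M) * (N M / real M - 2 / real M))
        \<longlonglongrightarrow> 1 * (1 - 0) * (1 - 0)"
      by (intro tendsto_intros Nlim one_over)
    then have "(\<lambda>M. (c M / real M ^ 3) /
        ((N M / real M) * (N M / real M - 1 / real M) * (N M / real M - 2 / real M))) \<longlonglongrightarrow> ?L / 1"
      using clim by (intro tendsto_divide) auto
    moreover have "\<forall>\<^sub>F M in sequentially. (c M / real M ^ 3) /
        ((N M / real M) * (N M / real M - 1 / real M) * (N M / real M - 2 / real M)) =
        c M / (N M * (N M - 1) * (N M - 2))"
      using eventually_gt_at_top[of 0]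
    proof eventually_elim
      case (elim M)
      have "(N M / real M) * (N M / real M - 1 / real M) * (N M / real M - 2 / real M) =
          (N M * (N M - 1) * (N M - 2)) / real M ^ 3"
        by (simp add: power3_eq_cube diff_divide_distrib[symmetric])
      then show ?case using elim by simp
    qed
    ultimately show ?thesis
      unfolding c_def by (auto intro: Lim_transform_eventually)
  qed
  have adj: "adj (G M) x y \<longleftrightarrow> x \<noteq> y \<and> R (block x) (block y)" for M x y
    by (simp add: G_def blow_up_def adj_def)
  have "triples (G M) (\<lambda>x y z. adj (G M) x y \<and> adj (G M) x z \<and> \<not> adj (G M) y z) =
      triples (G M) (\<lambda>x y z. R (block x) (block y) \<and> R (block x) (block z) \<and> \<not> R (block y) (block z))"
    and "triples (G M) (\<lambda>x y z. adj (G M) x y \<and> adj (G M) x z \<and> adj (G M) y z) =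
      triples (G M) (\<lambda>x y z. R (block x) (block y) \<and> R (block x) (block z) \<and> R (block y) (block z))"
    for M by (auto simp: triples_def adj)
  then have eqs: "ind_density (H3 2) (G M) = 3 * (real (card (triples (G M) (\<lambda>x y z. R (block x) (block y) \<and>
        R (block x) (block z) \<and> \<not> R (block y) (block z)))) / (N M * (N M - 1) * (N M - 2)))"
    "ind_density (H3 3) (G M) = real (card (triples (G M) (\<lambda>x y z. R (block x) (block y) \<and>
        R (block x) (block z) \<and> R (block y) (block z)))) / (N M * (N M - 1) * (N M - 2))" for M
    unfolding ind_density_triples[OF G] N_def by simp_all
  show ?thesis
  proof (rule S23I[of G])
    show "M \<le> card (verts (G M))" for M using N_ge[of M] by (simp add: N_def)
    show "(\<lambda>M. ind_density (H3 2) (G M)) \<longlonglongrightarrow>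
        3 * (\<Sum>i<K. \<Sum>j<K. \<Sum>l<K. w i * w j * w l * of_bool (R i j \<and> R i l \<and> \<not> R j l))"
      unfolding eqs by (intro tendsto_mult tendsto_const lim)
    show "(\<lambda>M. ind_density (H3 3) (G M)) \<longlonglongrightarrow>
        (\<Sum>i<K. \<Sum>j<K. \<Sum>l<K. w i * w j * w l * of_bool (R i j \<and> R i l \<and> R j l))"
      unfolding eqs by (rule lim)
  qed (rule G)
qed

text \<open>Here \<open>k\<close> independent blocks of relative sizes \<open>u * p i\<close> and a clique block of relative size
  \<open>1 - u\<close> are completely joined, and isolated vertices dilute the graph to the proportion \<open>c\<close>.\<close>
lemma multipartite_clique_in_S23:
  fixes p :: "nat \<Rightarrow> real"
  assumes p: "\<And>i. i < k \<Longrightarrow> 0 \<le> p i" "(\<Sum>i<k. p i) = 1"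
    and c: "0 \<le> c" "c \<le> 1" and u: "0 \<le> u" "u \<le> 1"
  defines "\<mu> \<equiv> \<Sum>i<k. (p i)^2" and "\<rho> \<equiv> \<Sum>i<k. (p i)^3"
  shows "(c^3 * (3 * (u^2 * \<mu> - u^3 * \<rho>)), c^3 * (1 - 3 * u^2 * \<mu> + 2 * u^3 * \<rho>)) \<in> S23"
proof -
  \<comment> \<open>Blocks below \<open>k\<close> are independent, block \<open>k\<close> is the
    clique, and block \<open>k + 1\<close> holds the isolated vertices.\<close>
  define K where "K = Suc (Suc k)"
  define R where "R i j \<longleftrightarrow> i \<le> k \<and> j \<le> k \<and> (i \<noteq> j \<or> i = k)" for i j
  define w where "w i = (if i < k then c * u * p i else if i = k then c * (1 - u) else 1 - c)" for i
  \<comment> \<open>\<open>v\<close> keeps the non-isolated blocks and \<open>v'\<close> the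
    independent ones, while \<open>\<delta>\<close> detects a common independent block. Between
    non-isolated blocks, \<open>R i j\<close> means \<open>\<delta> i j = 0\<close>, so all counts
    become power sums of \<open>v'\<close>.\<close>
  define v where "v i = (if i \<le> k then w i else 0)" for i
  define v' where "v' i = (if i < k then w i else 0)" for i
  define \<delta> where "\<delta> i j = (if i = j \<and> i < k then 1 else 0 :: real)" for i j
  have mem: "(3 * (\<Sum>i<K. \<Sum>j<K. \<Sum>l<K. w i * w j * w l * of_bool (R i j \<and> R i l \<and> \<not> R j l)),
    \<Sum>i<K. \<Sum>j<K. \<Sum>l<K. w i * w j * w l * of_bool (R i j \<and> R i l \<and> R j l)) \<in> S23"
  proof (rule step_graph_in_S23)
    show "0 \<le> w j" for j using p(1)[of j] c u by (auto simp: w_def)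
    show "(\<Sum>j<K. w j) = 1"
      using p(2) by (simp add: K_def w_def sum_distrib_left[symmetric] algebra_simps)
  qed (auto simp: R_def)
  have delta: "(\<Sum>l<K. v l * (\<delta> i l * f l)) = v' i * f i" for i f
  proof -
    have "v l * (\<delta> i l * f l) = (if i = l then v' i * f i else 0)" for l
      by (auto simp: v_def v'_def \<delta>_def)
    then have "(\<Sum>l<K. v l * (\<delta> i l * f l)) = (if i < K then v' i * f i else 0)"
      by (simp only: sum.delta' finite_lessThan) simp
    then show ?thesis by (auto simp: v'_def K_def)
  qed
  have delta1: "(\<Sum>l<K. v l * \<delta> i l) = v' i" for i
    using delta[of i "\<lambda>_. 1"] by simp
  have v_sum: "(\<Sum>i<K. v i) = c"
    using p(2) by (simp add: K_def v_def w_def sum_distrib_left[symmetric] algebra_simps)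
  define m2 where "m2 = (\<Sum>i<K. v i * v' i)"
  define m3 where "m3 = (\<Sum>i<K. v i * (v' i * v' i))"
  have m2: "m2 = c^2 * u^2 * \<mu>"
    by (simp add: m2_def K_def v_def v'_def w_def \<mu>_def sum_distrib_left power2_eq_square mult_ac)
  have m3: "m3 = c^3 * u^3 * \<rho>"
    by (simp add: m3_def K_def v_def v'_def w_def \<rho>_def sum_distrib_left power3_eq_cube mult_ac)
  have vv': "v i * v' i = v' i * v' i" for i by (simp add: v_def v'_def)
  have cherry: "(\<Sum>i<K. \<Sum>j<K. \<Sum>l<K. w i * w j * w l * of_bool (R i j \<and> R i l \<and> \<not> R j l)) = c * m2 - m3"
  proof -
    have l: "(\<Sum>l<K. w i * w j * w l * of_bool (R i j \<and> R i l \<and> \<not> R j l)) =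
        v i * (v j * v' j - v j * (\<delta> i j * v' j))" for i j
    proof -
      \<comment> \<open>The leaves of an induced path lie in one independent block, different from
        that of the centre.\<close>
      have "(\<Sum>l<K. w i * w j * w l * of_bool (R i j \<and> R i l \<and> \<not> R j l)) =
          (\<Sum>l<K. v i * v j * (1 - \<delta> i j) * (v l * (\<delta> j l * (1 - \<delta> i l))))"
        by (intro sum.cong) (auto simp: R_def v_def \<delta>_def)
      also have "\<dots> = v i * v j * (1 - \<delta> i j) * (v' j * (1 - \<delta> i j))"
        by (simp only: sum_distrib_left[symmetric] delta)
      also have "\<dots> = v i * (v j * v' j - v j * (\<delta> i j * v' j))"
        by (simp add: \<delta>_def)
      finally show ?thesis .
    qed
    have j: "(\<Sum>j<K. v i * (v j * v' j - v j * (\<delta> i j * v' j))) = m2 * v i - v i * (v' i * v' i)" for i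
      by (simp only: sum_distrib_left[symmetric] sum_subtractf delta m2_def[symmetric]) (simp add: algebra_simps)
    show ?thesis unfolding l j
      by (simp add: sum_subtractf sum_distrib_left[symmetric] v_sum m3_def)
  qed
  have triangle: "(\<Sum>i<K. \<Sum>j<K. \<Sum>l<K. w i * w j * w l * of_bool (R i j \<and> R i l \<and> R j l)) =
      c^3 - 3 * c * m2 + 2 * m3"
  proof -
    have l: "(\<Sum>l<K. w i * w j * w l * of_bool (R i j \<and> R i l \<and> R j l)) =
        v i * ((v j - v j * \<delta> i j) * (c - v' i) - (v j * v' j - v j * (\<delta> i j * v' j)))" for i j
    proof -
      \<comment> \<open>If \<open>i\<close> and \<open>j\<close> are in no common independent block,
        \<open>l\<close> can share one with at most one of them, so the two exclusions simply
        add.\<close>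
      have "(\<Sum>l<K. w i * w j * w l * of_bool (R i j \<and> R i l \<and> R j l)) =
          (\<Sum>l<K. v i * v j * (1 - \<delta> i j) * (v l - v l * \<delta> i l - v l * \<delta> j l))"
        by (intro sum.cong) (auto simp: R_def v_def \<delta>_def)
      also have "\<dots> = v i * v j * (1 - \<delta> i j) * (c - v' i - v' j)"
        by (simp only: sum_distrib_left[symmetric] sum_subtractf delta1 v_sum)
      finally show ?thesis by (simp add: algebra_simps)
    qed
    have j: "(\<Sum>j<K. v i * ((v j - v j * \<delta> i j) * (c - v' i) - (v j * v' j - v j * (\<delta> i j * v' j)))) =
        (c^2 - m2) * v i - 2 * c * (v i * v' i) + 2 * (v i * (v' i * v' i))" for i
    proof -
      have "(\<Sum>j<K. v i * ((v j - v j * \<delta> i j) * (c - v' i) - (v j * v' j - v j * (\<delta> i j * v' j)))) =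
          v i * ((c - v' i) * (c - v' i) - (m2 - v' i * v' i))"
        by (simp only: sum_distrib_left[symmetric] sum_distrib_right[symmetric] sum_subtractf delta
            delta1 v_sum m2_def[symmetric])
      then show ?thesis by (simp add: algebra_simps power2_eq_square)
    qed
    show ?thesis unfolding l j
      by (simp only: sum_subtractf sum.distrib sum_distrib_left[symmetric] v_sum m2_def[symmetric]
          m3_def[symmetric]) (simp add: algebra_simps power2_eq_square power3_eq_cube)
  qed
  have "3 * (c * m2 - m3) = c^3 * (3 * (u^2 * \<mu> - u^3 * \<rho>))"
    "c^3 - 3 * c * m2 + 2 * m3 = c^3 * (1 - 3 * u^2 * \<mu> + 2 * u^3 * \<rho>)"
    unfolding m2 m3 by (simp_all add: algebra_simps power2_eq_square power3_eq_cube)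
  then show ?thesis using mem unfolding cherry triangle by simp
qed

text \<open>For fixed \<open>u\<close>, diluting by isolated vertices multiplies both densities by
  \<open>c^3\<close>, so only their ratio has to be matched through \<open>u\<close>;
  \<open>c\<close> then adjusts \<open>d3\<close>.\<close>

lemma S23_lower:
  assumes d: "0 \<le> d2" "0 \<le> d3" "d3 \<le> 1" "d2 \<le> 3/2 * (g_R_inv d3 - d3)"
  shows "(d2, d3) \<in> S23"
proof -
  consider "d3 = 0" | "d3 = 1" | "0 < d3" "d3 < 1" using d by linarith
  then show ?thesis
  proof cases
    case 1
    \<comment> \<open>A balanced complete bipartite graph has \<open>d2 = 3/4\<close> and no
      triangles.\<close>
    define c where "c = root 3 (4/3 * d2)"
    have "4/3 * d2 \<le> 1" using d 1 by (simp add: g_R_inv_0)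
    then have c: "0 \<le> c" "c \<le> 1" "c^3 = 4/3 * d2"
      using d by (auto simp: c_def odd_real_root_pow)
    have "(c^3 * (3 * (1^2 * (\<Sum>i<(2::nat). (1/2)^2) - 1^3 * (\<Sum>i<(2::nat). (1/2)^3))),
        c^3 * (1 - 3 * 1^2 * (\<Sum>i<(2::nat). (1/2)^2) + 2 * 1^3 * (\<Sum>i<(2::nat). (1/2)^3))) \<in> S23"
      using c by (intro multipartite_clique_in_S23[of 2 "\<lambda>_. 1/2"]) auto
    then show ?thesis using 1 c(3) by (simp add: power2_eq_square power3_eq_cube)
  next
    case 2
    then have "d2 = 0" using d g_R_inv[of 1] by simp
    \<comment> \<open>With \<open>u = 0\<close> and \<open>c = 1\<close> the whole graph is a
      clique.\<close>
    moreover have "(1^3 * (3 * (0^2 * (\<Sum>i<(1::nat). 1^2) - 0^3 * (\<Sum>i<(1::nat). 1^3))),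
        1^3 * (1 - 3 * 0^2 * (\<Sum>i<(1::nat). 1^2) + 2 * 0^3 * (\<Sum>i<(1::nat). 1^3))) \<in> S23"
      by (intro multipartite_clique_in_S23[of 1 "\<lambda>_. 1"]) auto
    ultimately show ?thesis using 2 by simp
  next
    case 3
    obtain k z where k: "3 \<le> k" "0 < z" "z \<le> 1 / real k" "d3 = part_triangles k z"
      using part_triangles_surj[OF 3] by metis
    define a where "a = (1 - z) / (real k - 1)"
    define p where "p i = (if i = 0 then z else a)" for i :: nat
    define \<mu> where "\<mu> = (\<Sum>i<k. (p i)^2)"
    define \<rho> where "\<rho> = (\<Sum>i<k. (p i)^3)"
    have "1 / real k \<le> 1" using k by simp
    then have z1: "z \<le> 1" using k by linarith
    have a: "0 \<le> a" using z1 k by (simp add: a_def)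
    have aK: "(real k - 1) * a = 1 - z" using k by (simp add: a_def)
    obtain n where n: "k = Suc n" using k(1) by (cases k) auto
    have sum_p: "(\<Sum>i<k. f (p i)) = f z + (real k - 1) * f a" for f :: "real \<Rightarrow> real"
      unfolding n by (subst sum.lessThan_Suc_shift) (simp add: p_def)
    have p: "\<And>i. i < k \<Longrightarrow> 0 \<le> p i" "(\<Sum>i<k. p i) = 1"
      using a k sum_p[of "\<lambda>x. x"] aK by (auto simp: p_def)
    have \<mu>: "\<mu> = z^2 + (1 - z) * a" and \<rho>: "\<rho> = z^3 + (1 - z) * a^2"
      unfolding \<mu>_def \<rho>_def sum_p[of "\<lambda>x. x^2"] sum_p[of "\<lambda>x. x^3"] aK[symmetric]
      by (simp_all add: power2_eq_square power3_eq_cube)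
    have z_eq: "z = 1 - (real k - 1) * a" using aK by simp
    have e_eq: "part_edges k z = 1 - \<mu>"
    proof -
      have "part_edges k z = a * (real k * z + real k - 2)" by (simp add: part_edges_def a_def)
      then show ?thesis unfolding \<mu> z_eq by (simp add: algebra_simps power2_eq_square)
    qed
    have t_eq: "d3 = 1 - 3 * \<mu> + 2 * \<rho>"
    proof -
      have "part_triangles k z = a^2 * (real k - 2) * (2 * z * real k + real k - 3)"
        by (simp add: part_triangles_def a_def power_divide)
      then show ?thesis unfolding k(4) \<mu> \<rho> z_eq
        by (simp add: algebra_simps power2_eq_square power3_eq_cube)
    qed
    have "d2 \<le> 3/2 * (part_edges k z - d3)"
      using d(4) g_R_inv_part_triangles[OF k(1-3)] k(4) by simp
    then have d2_le: "d2 \<le> 3 * (\<mu> - \<rho>)" unfolding e_eq t_eq by simp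
    have "p i \<le> 1" for i using z1 k a by (auto simp: p_def a_def divide_le_eq)
    then have "\<rho> \<le> \<mu>" unfolding \<mu>_def \<rho>_def using p(1)
      by (intro sum_mono) (auto intro!: power_decreasing)
    \<comment> \<open>Triangle density before dilution. \<open>T 1 = d3\<close> is the extremal
      multipartite graph, and \<open>d3 \<le> T u\<close> guarantees that the dilution factor is at
      most 1.\<close>
    define T where "T u = 1 - 3 * u^2 * \<mu> + 2 * u^3 * \<rho>" for u
    have T_ge: "d3 \<le> T u" if u: "0 \<le> u" "u \<le> 1" for u
    proof -
      have "T u - d3 = (1 - u) * (3 * (1 + u) * (\<mu> - \<rho>) + (1 - u) * (1 + 2 * u) * \<rho>)"
        unfolding T_def t_eq by (simp add: algebra_simps power2_eq_square power3_eq_cube)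
      moreover have "0 \<le> \<rho>" unfolding \<rho>_def using p(1) by (intro sum_nonneg) auto
      then have "0 \<le> (1 - u) * (3 * (1 + u) * (\<mu> - \<rho>) + (1 - u) * (1 + 2 * u) * \<rho>)"
        using u \<open>\<rho> \<le> \<mu>\<close> by (intro mult_nonneg_nonneg add_nonneg_nonneg) auto
      ultimately show ?thesis by linarith
    qed
    \<comment> \<open>At \<open>u = 1\<close> the cherry density is
      \<open>3 * (\<mu> - \<rho>)\<close>, equal to the upper bound
      \<open>3/2 * (g_R_inv d3 - d3)\<close>; at \<open>u = 0\<close> it is 0.\<close>
    have "\<exists>u. 0 \<le> u \<and> u \<le> 1 \<and> 3 * (u^2 * \<mu> - u^3 * \<rho>) / T u = d2 / d3"
    proof (rule IVT')
      show "3 * (0^2 * \<mu> - 0^3 * \<rho>) / T 0 \<le> d2 / d3" using d 3 by simp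
      show "d2 / d3 \<le> 3 * (1^2 * \<mu> - 1^3 * \<rho>) / T 1"
        using d2_le 3 t_eq by (simp add: T_def divide_right_mono)
      have "T u \<noteq> 0" if "u \<in> {0..1}" for u using T_ge[of u] that 3 by auto
      then show "continuous_on {0..1} (\<lambda>u. 3 * (u^2 * \<mu> - u^3 * \<rho>) / T u)"
        unfolding T_def by (intro continuous_intros) auto
    qed simp
    then obtain u where u: "0 \<le> u" "u \<le> 1" "3 * (u^2 * \<mu> - u^3 * \<rho>) / T u = d2 / d3" by blast
    have Tu: "d3 \<le> T u" "0 < T u" using T_ge[OF u(1,2)] 3 by auto
    define c where "c = root 3 (d3 / T u)"
    have c: "0 \<le> c" "c \<le> 1" "c^3 = d3 / T u"
      using Tu 3 by (auto simp: c_def odd_real_root_pow divide_le_eq)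
    have "c^3 * (3 * (u^2 * \<mu> - u^3 * \<rho>)) = d3 * (3 * (u^2 * \<mu> - u^3 * \<rho>) / T u)"
      unfolding c(3) by simp
    also have "\<dots> = d2" unfolding u(3) using 3 by simp
    finally have "c^3 * (3 * (u^2 * \<mu> - u^3 * \<rho>)) = d2" .
    moreover have "c^3 * T u = d3" unfolding c(3) using Tu by simp
    moreover have "(c^3 * (3 * (u^2 * \<mu> - u^3 * \<rho>)), c^3 * T u) \<in> S23"
      unfolding T_def \<mu>_def \<rho>_def by (rule multipartite_clique_in_S23[OF p c(1,2) u(1,2)])
    ultimately show ?thesis by (simp only:)
  qed
qed

theorem theorem14:
  shows "S23 = {(d2, d3). 0 \<le> d2 \<and> 0 \<le> d3 \<and> d3 \<le> 1 \<and>
                          d2 \<le> 3/2 * (g_R_inv d3 - d3)}"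
proof (intro set_eqI iffI; clarify)
  fix d2 d3
  assume "(d2, d3) \<in> S23"
  then show "0 \<le> d2 \<and> 0 \<le> d3 \<and> d3 \<le> 1 \<and> d2 \<le> 3/2 * (g_R_inv d3 - d3)"
    by (intro conjI S23_upper)
next
  fix d2 d3
  assume "0 \<le> d2" "0 \<le> d3" "d3 \<le> 1" "d2 \<le> 3/2 * (g_R_inv d3 - d3)"
  then show "(d2, d3) \<in> S23" by (rule S23_lower)
qed

end
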